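(* Let $\mathcal{M}$ be a von Neumann algebra and let $\mathbf{\Phi}=\{\Phi_t\}_{t\geq0}$ be a $w^*$-continuous semigroup of $w^*$-continuous, unital, completely positive maps on $\mathcal{M}$. Then: (a) There exists a completely positive, unital, and idempotent map $\Psi\colon\mathcal{M}\to\mathcal{M}$ such that the set of joint fixed points $\mathcal{M}^{\mathbf{\Phi}}$ is the range of $\Psi$. (b) With $\Psi$ as in (a), the following assertions are equivalent: (i) $\mathcal{M}^{\mathbf{\Phi}}$ is stable under multiplication. (ii) $\mathcal{M}^{\mathbf{\Phi}}$ is a von Neumann algebra. (iii) $\mathcal{M}^{\mathbf{\Phi}}=\mathcal{I}(\mathbf{\Phi})$. (iv) $\Psi$ is a conditional expectation. (c) If $\mathcal{M}=\mathcal{B}(\mathcal{H})$ for a Hilbert space $\mathcal{H}$ and $\mathcal{B}(\mathcal{H})^{\mathbf{\Phi}}$ is stable under multiplication, then $\mathcal{B}(\mathcal{H})^{\mathbf{\Phi}}$ is an injective von Neumann algebra.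
   Context: A $w^*$-continuous semigroup on $\mathcal{M}$ satisfies $\Phi_s\Phi_t=\Phi_{s+t}$ for $s,t\ge0$, $\Phi_0=I$, and $t\mapsto\Phi_t(a)$ is $w^*$-continuous on $[0,\infty)$ for every $a\in\mathcal{M}$. The set of joint fixed points is $\mathcal{M}^{\mathbf{\Phi}}=\{a\in\mathcal{M}\mid\Phi_t(a)=a\text{ for all }t\geq0\}$. The joint bimodule domain is $\mathcal{I}(\mathbf{\Phi})=\{a\in\mathcal{M}\mid\Phi_t(ab)=a\Phi_t(b),\ \Phi_t(ba)=\Phi_t(b)a\text{ for all }b\in\mathcal{M}\text{ and all }t\geq0\}$. A linear map $\Psi\colon\mathcal{M}\to\mathcal{M}$ is a conditional expectation if it is positive, idempotent ($\Psi\Psi=\Psi$), and $\Psi(ar)=\Psi(a)r$, $\Psi(ra)=r\Psi(a)$ for all $a\in\mathcal{M}$ and all $r\in\operatorname{Ran}(\Psi)$. A subspace $\mathcal{V}\subseteq\mathcal{B}(\mathcal{H})$ is injective if there is a completely contractive idempotent linear map $\mathcal{B}(\mathcal{H})\to\mathcal{B}(\mathcal{H})$ with range equal to $\mathcal{V}$. *)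

theory Defs
  imports "HOL-Analysis.Analysis"
begin

text \<open>
  Complex Hilbert spaces. The norm and the metric are those of the underlying real inner product
  space, whose inner product is the real part of the complex one; positive definiteness of
  \<open>cinner\<close> is thus inherited. \<open>cinner\<close> is linear in its first argument.
\<close>

class chilbert_space = real_inner + complete_space +
  fixes scaleC :: "complex \<Rightarrow> 'a \<Rightarrow> 'a" (infixr "*\<^sub>C" 75)
    and cinner :: "'a \<Rightarrow> 'a \<Rightarrow> complex"
  assumes scaleC_add_right: "c *\<^sub>C (x + y) = c *\<^sub>C x + c *\<^sub>C y"
    and scaleC_add_left: "(c + d) *\<^sub>C x = c *\<^sub>C x + d *\<^sub>C x"
    and scaleC_scaleC: "c *\<^sub>C d *\<^sub>C x = (c * d) *\<^sub>C x"
    and scaleC_of_real: "complex_of_real r *\<^sub>C x = r *\<^sub>R x"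
    and cinner_commute: "cinner x y = cnj (cinner y x)"
    and cinner_add_left: "cinner (x + y) z = cinner x z + cinner y z"
    and cinner_scaleC_left: "cinner (c *\<^sub>C x) y = c * cinner x y"
    and Re_cinner: "Re (cinner x y) = inner x y"
begin

subclass banach ..

end

lemma cinner_self: "cinner x x = complex_of_real ((norm x)\<^sup>2)"
  for x :: "'h::chilbert_space"
proof (rule complex_eqI)
  have "Im (cinner x x) = Im (cnj (cinner x x))"
    using cinner_commute[of x x] by simp
  then show "Im (cinner x x) = Im (complex_of_real ((norm x)\<^sup>2))" by simp
qed (simp add: Re_cinner power2_norm_eq_inner)

lemma norm_scaleC: "norm (c *\<^sub>C x) = cmod c * norm x"
  for x :: "'h::chilbert_space"
proof -
  have "cinner (c *\<^sub>C x) (c *\<^sub>C x) = c * cnj c * cinner x x"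
    by (metis cinner_commute cinner_scaleC_left complex_cnj_mult mult.assoc)
  then have "complex_of_real ((norm (c *\<^sub>C x))\<^sup>2) = complex_of_real ((cmod c * norm x)\<^sup>2)"
    by (simp add: cinner_self complex_norm_square power_mult_distrib del: of_real_power)
  then have "(norm (c *\<^sub>C x))\<^sup>2 = (cmod c * norm x)\<^sup>2"
    using of_real_eq_iff by blast
  then show ?thesis by (simp add: power2_eq_iff_nonneg)
qed

lemma bounded_linear_scaleC: "bounded_linear (\<lambda>x :: 'h::chilbert_space. c *\<^sub>C x)"
proof (rule bounded_linear_intro[where K = "cmod c"])
  show "c *\<^sub>C (r *\<^sub>R x) = r *\<^sub>R (c *\<^sub>C x)" for r and x :: 'h
    by (metis mult.commute scaleC_of_real scaleC_scaleC)
qed (simp_all add: scaleC_add_right norm_scaleC mult.commute)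

text \<open>
  \<open>'h \<Rightarrow>\<^sub>L 'h\<close> is the type of bounded \<^emph>\<open>real\<close>-linear operators;
  \<open>bops\<close> is the algebra \<open>\<B>(\<H>)\<close> of the complex-linear ones among them.
\<close>

definition bops :: "('h::chilbert_space \<Rightarrow>\<^sub>L 'h) set" where
  "bops = {T :: 'h \<Rightarrow>\<^sub>L 'h. \<forall>c x. T (c *\<^sub>C x) = c *\<^sub>C T x}"

lift_definition scale_op ::
    "complex \<Rightarrow> ('h::chilbert_space \<Rightarrow>\<^sub>L 'h) \<Rightarrow> ('h \<Rightarrow>\<^sub>L 'h)"
  is "\<lambda>c T x. c *\<^sub>C T x"
  by (rule bounded_linear_compose[OF bounded_linear_scaleC])

definition adj :: "('h::chilbert_space \<Rightarrow>\<^sub>L 'h) \<Rightarrow> ('h \<Rightarrow>\<^sub>L 'h)" where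
  "adj T = (THE S :: 'h \<Rightarrow>\<^sub>L 'h. \<forall>x y. cinner (T x) y = cinner x (S y))"

text \<open>
  The w*-topology (ultraweak topology) of \<open>\<B>(\<H>)\<close>, generated by the functionals
  \<open>T \<mapsto> \<Sum>\<^sub>n \<langle>T x\<^sub>n, y\<^sub>n\<rangle>\<close> with square-summable \<open>x\<close> and \<open>y\<close>, which form the predual
  of \<open>\<B>(\<H>)\<close>. The w*-topology of a von Neumann algebra on \<open>\<H>\<close> is the relative topology.
\<close>

definition wstar :: "('h::chilbert_space \<Rightarrow>\<^sub>L 'h) topology" where
  "wstar = subtopology
     (topology_generated_by
       {{T :: 'h \<Rightarrow>\<^sub>L 'h. (\<Sum>n. cinner (T (x n)) (y n)) \<in> U} | x y U.
          summable (\<lambda>n::nat. (norm (x n))\<^sup>2) \<and> summable (\<lambda>n. (norm (y n))\<^sup>2) \<and> open U})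
     bops"

definition mult_stable :: "('h::chilbert_space \<Rightarrow>\<^sub>L 'h) set \<Rightarrow> bool" where
  "mult_stable S \<longleftrightarrow> (\<forall>a\<in>S. \<forall>b\<in>S. a o\<^sub>L b \<in> S)"

definition von_neumann_algebra :: "('h::chilbert_space \<Rightarrow>\<^sub>L 'h) set \<Rightarrow> bool" where
  "von_neumann_algebra M \<longleftrightarrow>
     M \<subseteq> bops \<and> id_blinfun \<in> M \<and>
     (\<forall>a\<in>M. \<forall>b\<in>M. a + b \<in> M) \<and> (\<forall>c. \<forall>a\<in>M. scale_op c a \<in> M) \<and>
     mult_stable M \<and> (\<forall>a\<in>M. adj a \<in> M) \<and> closedin wstar M"

text \<open>
  Maps between spaces of operators are total functions on \<open>'h \<Rightarrow>\<^sub>L 'h\<close> of which only the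
  values on the given space \<open>V\<close> matter.
\<close>

definition linear_selfmap ::
    "('h::chilbert_space \<Rightarrow>\<^sub>L 'h) set \<Rightarrow> (('h \<Rightarrow>\<^sub>L 'h) \<Rightarrow> ('h \<Rightarrow>\<^sub>L 'h)) \<Rightarrow> bool" where
  "linear_selfmap V f \<longleftrightarrow>
     f ` V \<subseteq> V \<and> (\<forall>a\<in>V. \<forall>b\<in>V. f (a + b) = f a + f b) \<and>
     (\<forall>c. \<forall>a\<in>V. f (scale_op c a) = scale_op c (f a))"

definition idempotent_on :: "'a set \<Rightarrow> ('a \<Rightarrow> 'a) \<Rightarrow> bool" where
  "idempotent_on V f \<longleftrightarrow> (\<forall>a\<in>V. f (f a) = f a)"

definition positive_op :: "('h::chilbert_space \<Rightarrow>\<^sub>L 'h) \<Rightarrow> bool" where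
  "positive_op a \<longleftrightarrow> (\<forall>x. cinner (a x) x \<in> \<real>\<^sub>\<ge>\<^sub>0)"

text \<open>
  An \<open>n \<times> n\<close> operator matrix is given by its entries \<open>A i j\<close> with \<open>i, j < n\<close> and acts on
  \<open>\<H>\<^sup>n\<close> by \<open>(A x)\<^sub>i = \<Sum>\<^sub>j A i j x\<^sub>j\<close>. Positivity and norm are those of this operator on the
  Hilbert space \<open>\<H>\<^sup>n\<close>.
\<close>

definition mat_apply ::
    "nat \<Rightarrow> (nat \<Rightarrow> nat \<Rightarrow> ('h::chilbert_space \<Rightarrow>\<^sub>L 'h)) \<Rightarrow> (nat \<Rightarrow> 'h) \<Rightarrow> nat \<Rightarrow> 'h" where
  "mat_apply n A x i = (\<Sum>j<n. A i j (x j))"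

definition positive_mat :: "nat \<Rightarrow> (nat \<Rightarrow> nat \<Rightarrow> ('h::chilbert_space \<Rightarrow>\<^sub>L 'h)) \<Rightarrow> bool" where
  "positive_mat n A \<longleftrightarrow> (\<forall>x. (\<Sum>i<n. cinner (mat_apply n A x i) (x i)) \<in> \<real>\<^sub>\<ge>\<^sub>0)"

definition mat_norm :: "nat \<Rightarrow> (nat \<Rightarrow> nat \<Rightarrow> ('h::chilbert_space \<Rightarrow>\<^sub>L 'h)) \<Rightarrow> real" where
  "mat_norm n A =
     (SUP x\<in>{x. (\<Sum>j<n. (norm (x j))\<^sup>2) \<le> 1}. sqrt (\<Sum>i<n. (norm (mat_apply n A x i))\<^sup>2))"

definition positive_map ::
    "('h::chilbert_space \<Rightarrow>\<^sub>L 'h) set \<Rightarrow> (('h \<Rightarrow>\<^sub>L 'h) \<Rightarrow> ('h \<Rightarrow>\<^sub>L 'h)) \<Rightarrow> bool" where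
  "positive_map V f \<longleftrightarrow>
     linear_selfmap V f \<and> (\<forall>a\<in>V. positive_op a \<longrightarrow> positive_op (f a))"

definition completely_positive ::
    "('h::chilbert_space \<Rightarrow>\<^sub>L 'h) set \<Rightarrow> (('h \<Rightarrow>\<^sub>L 'h) \<Rightarrow> ('h \<Rightarrow>\<^sub>L 'h)) \<Rightarrow> bool" where
  "completely_positive V f \<longleftrightarrow>
     linear_selfmap V f \<and>
     (\<forall>n A. (\<forall>i<n. \<forall>j<n. A i j \<in> V) \<and> positive_mat n A \<longrightarrow> positive_mat n (\<lambda>i j. f (A i j)))"

definition completely_contractive ::
    "('h::chilbert_space \<Rightarrow>\<^sub>L 'h) set \<Rightarrow> (('h \<Rightarrow>\<^sub>L 'h) \<Rightarrow> ('h \<Rightarrow>\<^sub>L 'h)) \<Rightarrow> bool" where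
  "completely_contractive V f \<longleftrightarrow>
     linear_selfmap V f \<and>
     (\<forall>n A. (\<forall>i<n. \<forall>j<n. A i j \<in> V) \<longrightarrow> mat_norm n (\<lambda>i j. f (A i j)) \<le> mat_norm n A)"

definition conditional_expectation ::
    "('h::chilbert_space \<Rightarrow>\<^sub>L 'h) set \<Rightarrow> (('h \<Rightarrow>\<^sub>L 'h) \<Rightarrow> ('h \<Rightarrow>\<^sub>L 'h)) \<Rightarrow> bool" where
  "conditional_expectation M f \<longleftrightarrow>
     positive_map M f \<and> idempotent_on M f \<and>
     (\<forall>a\<in>M. \<forall>r\<in>f ` M. f (a o\<^sub>L r) = f a o\<^sub>L r \<and> f (r o\<^sub>L a) = r o\<^sub>L f a)"

definition injective_space :: "('h::chilbert_space \<Rightarrow>\<^sub>L 'h) set \<Rightarrow> bool" where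
  "injective_space V \<longleftrightarrow>
     (\<exists>E. completely_contractive bops E \<and> idempotent_on bops E \<and> E ` bops = V)"

text \<open>Semigroups are indexed by \<open>real\<close>; only parameters \<open>t \<ge> 0\<close> matter.\<close>

definition wstar_semigroup ::
    "('h::chilbert_space \<Rightarrow>\<^sub>L 'h) set \<Rightarrow> (real \<Rightarrow> ('h \<Rightarrow>\<^sub>L 'h) \<Rightarrow> ('h \<Rightarrow>\<^sub>L 'h)) \<Rightarrow> bool" where
  "wstar_semigroup M \<Phi> \<longleftrightarrow>
     (\<forall>s\<ge>0. \<forall>t\<ge>0. \<forall>a\<in>M. \<Phi> s (\<Phi> t a) = \<Phi> (s + t) a) \<and>
     (\<forall>a\<in>M. \<Phi> 0 a = a) \<and>
     (\<forall>a\<in>M. continuous_map (top_of_set {0..}) (subtopology wstar M) (\<lambda>t. \<Phi> t a))"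

definition wstar_continuous ::
    "('h::chilbert_space \<Rightarrow>\<^sub>L 'h) set \<Rightarrow> (('h \<Rightarrow>\<^sub>L 'h) \<Rightarrow> ('h \<Rightarrow>\<^sub>L 'h)) \<Rightarrow> bool" where
  "wstar_continuous M f \<longleftrightarrow> continuous_map (subtopology wstar M) (subtopology wstar M) f"

definition fixed_points ::
    "('h::chilbert_space \<Rightarrow>\<^sub>L 'h) set \<Rightarrow> (real \<Rightarrow> ('h \<Rightarrow>\<^sub>L 'h) \<Rightarrow> ('h \<Rightarrow>\<^sub>L 'h)) \<Rightarrow> ('h \<Rightarrow>\<^sub>L 'h) set"
  where "fixed_points M \<Phi> = {a \<in> M. \<forall>t\<ge>0. \<Phi> t a = a}"

definition bimodule_domain ::
    "('h::chilbert_space \<Rightarrow>\<^sub>L 'h) set \<Rightarrow> (real \<Rightarrow> ('h \<Rightarrow>\<^sub>L 'h) \<Rightarrow> ('h \<Rightarrow>\<^sub>L 'h)) \<Rightarrow> ('h \<Rightarrow>\<^sub>L 'h) set"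
  where "bimodule_domain M \<Phi> =
    {a \<in> M. \<forall>b\<in>M. \<forall>t\<ge>0. \<Phi> t (a o\<^sub>L b) = a o\<^sub>L \<Phi> t b \<and> \<Phi> t (b o\<^sub>L a) = \<Phi> t b o\<^sub>L a}"

end

theory Submission
  imports Defs
begin

text \<open>
  The projection \<open>\<Psi>\<close> comes from a mean ergodic theorem. The averages
  \<open>A\<^sub>n a = 4\<^sup>-\<^sup>n \<Sum>\<^sub>k \<Phi>\<^sub>k\<^sub>h(a)\<close> over the \<open>4\<^sup>n\<close> times \<open>k h\<close> with mesh \<open>h = 2\<^sup>-\<^sup>n\<close> are unital,
  completely positive and contractive on \<open>M\<close>. Their matrix coefficients are bounded, so by
  Tychonoff's theorem they converge along a filter finer than \<open>sequentially\<close>, for all operators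
  and vectors at once (\<open>pointwise_convergent_filter\<close>). The limit form is represented by an operator
  \<open>\<Psi> a\<close>, by the Riesz theorem, and since bounded weak convergence is ultraweak convergence
  (\<open>limitin_wstar_bounded\<close>), \<open>\<Psi> a\<close> stays in \<open>M\<close> and the normal maps \<open>\<Phi>\<^sub>t\<close> pass to the limit.
  For dyadic \<open>t\<close>, applying \<open>\<Phi>\<^sub>t\<close> shifts the average by a number of terms that is negligible against
  \<open>4\<^sup>n\<close>, whence \<open>\<Phi>\<^sub>t \<Psi> = \<Psi>\<close>; continuity in \<open>t\<close> gives all \<open>t \<ge> 0\<close>. So \<open>\<Psi>\<close> maps into the fixed
  points, and it fixes them because each average does (\<open>ergodic_projection\<close>).

  The equivalences rest on Choi's multiplicative domain (\<open>cp_multiplicative_domain\<close>). If the joint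
  fixed points are stable under products and \<open>a\<close> is one of them, so are \<open>a\<^sup>* a\<close> and \<open>a a\<^sup>*\<close>. For the
  unital completely positive maps \<open>\<Phi>\<^sub>t\<close> and \<open>\<Psi>\<close>, which fix these operators, equality then holds in
  the Kadison--Schwarz inequality, and so both maps are bimodular with respect to \<open>a\<close>
  (\<open>cp_bimodule\<close>). For \<open>\<Phi>\<^sub>t\<close> this gives the bimodule domain, for \<open>\<Psi>\<close> it gives the
  conditional expectation; the converses are direct computations. The fixed points are in any case
  a self-adjoint ultraweakly closed subspace containing the identity, so stability under products
  is all that separates them from a von Neumann algebra. Finally, unital completely positive maps
  are completely contractive (\<open>cp_completely_contractive\<close>), so \<open>\<Psi>\<close> itself witnesses injectivity when
  \<open>M\<close> is the algebra of all bounded operators.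
\<close>

section \<open>The complex inner product\<close>

lemma cinner_add_right: "cinner x (y + z) = cinner x y + cinner x z"
  for x :: "'h::chilbert_space"
  by (metis cinner_add_left cinner_commute complex_cnj_add)

lemma cinner_scaleC_right: "cinner x (c *\<^sub>C y) = cnj c * cinner x y"
  for x :: "'h::chilbert_space"
  by (metis cinner_commute cinner_scaleC_left complex_cnj_mult)

lemma norm_cinner_le: "cmod (cinner x y) \<le> norm x * norm y"
  for x :: "'h::chilbert_space"
proof (cases "cinner x y = 0")
  case False
  \<comment> \<open>Rotating \<open>x\<close> by a unimodular scalar makes the inner product real and nonnegative.\<close>
  define c where "c = cnj (sgn (cinner x y))"
  have c: "cmod c = 1" using False by (simp add: c_def norm_sgn)
  have "c * cinner x y = complex_of_real (cmod (cinner x y))"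
    using False by (simp add: c_def sgn_div_norm scaleR_conv_of_real complex_norm_square[symmetric]
        mult.commute power2_eq_square field_simps)
  then have "cmod (cinner x y) = Re (cinner (c *\<^sub>C x) y)"
    by (simp add: cinner_scaleC_left)
  also have "\<dots> \<le> norm (c *\<^sub>C x) * norm y"
    by (simp add: Re_cinner norm_cauchy_schwarz)
  finally show ?thesis by (simp add: norm_scaleC c)
qed simp

interpretation cinner: bounded_bilinear "cinner :: 'h::chilbert_space \<Rightarrow> 'h \<Rightarrow> complex"
proof
  show "cinner (r *\<^sub>R x) y = r *\<^sub>R cinner x y" for r and x y :: 'h
    by (simp add: scaleC_of_real[symmetric] cinner_scaleC_left scaleR_conv_of_real)
  show "cinner x (r *\<^sub>R y) = r *\<^sub>R cinner x y" for r and x y :: 'h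
    by (simp add: scaleC_of_real[symmetric] cinner_scaleC_right scaleR_conv_of_real)
  show "\<exists>K. \<forall>(x::'h) y. norm (cinner x y) \<le> norm x * norm y * K"
    using norm_cinner_le by (intro exI[of _ 1]) auto
qed (auto intro: cinner_add_left cinner_add_right)

lemma cinner_ext: "(\<And>y. cinner x y = cinner z y) \<Longrightarrow> x = z"
  for x :: "'h::chilbert_space"
  by (metis Re_cinner vector_eq_rdot)

lemma blinfun_cinner_ext:
  fixes S T :: "'h::chilbert_space \<Rightarrow>\<^sub>L 'h"
  assumes "\<And>x y. cinner (S x) y = cinner (T x) y"
  shows "S = T"
  using assms cinner_ext by (intro blinfun_eqI) blast

text \<open>
  The usual passage from a positive quadratic form to a Cauchy--Schwarz estimate: \<open>s\<close> and \<open>t\<close> are the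
  norms of two vectors and \<open>r\<close> is the real part of their cross term. The scalings \<open>u = t\<close>, \<open>v = s\<close> are
  optimal; when one norm vanishes, the other scaling can be taken arbitrarily large.
\<close>

lemma quadratic_form_bound:
  fixes c r s t :: real
  assumes q: "\<And>u v. 0 \<le> c * (u * s)\<^sup>2 + 2 * (u * v) * r + c * (v * t)\<^sup>2"
    and "c \<ge> 0" "s \<ge> 0" "t \<ge> 0"
  shows "- r \<le> c * s * t"
proof (cases "s = 0 \<or> t = 0")
  case True
  have r: "r = 0" if "\<And>u. 0 \<le> d + 2 * u * r" for d
  proof (rule ccontr)
    assume "r \<noteq> 0"
    then show False using that[of "- (d + 1) / (2 * r)"] by (simp add: field_simps)
  qed
  from True show ?thesis
  proof
    assume s: "s = 0"
    have "r = 0" by (rule r[of "c * t\<^sup>2"]) (use q[of _ 1] s in \<open>simp add: algebra_simps\<close>)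
    with s show ?thesis by simp
  next
    assume t: "t = 0"
    have "r = 0" by (rule r[of "c * s\<^sup>2"]) (use q[of 1] t in \<open>simp add: algebra_simps\<close>)
    with t show ?thesis by simp
  qed
next
  case False
  have "0 \<le> c * (t * s)\<^sup>2 + 2 * (t * s) * r + c * (s * t)\<^sup>2" by (rule q)
  also have "\<dots> = 2 * (t * s) * (c * s * t + r)" by (simp add: power2_eq_square algebra_simps)
  finally have "0 \<le> 2 * (t * s) * (c * s * t + r)" .
  moreover have "0 < 2 * (t * s)" using False assms by simp
  ultimately have "0 \<le> c * s * t + r"
    using zero_le_mult_iff[of "2 * (t * s)" "c * s * t + r"] by linarith
  then show ?thesis by simp
qed

section \<open>Operators from sesquilinear forms\<close>

text \<open>
  The Riesz representation theorem. A vector of smallest norm on the closed hyperplane \<open>f = 1\<close>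
  is orthogonal to the kernel of \<open>f\<close>; by the parallelogram law a minimizing sequence converges.
\<close>

lemma riesz_real:
  fixes f :: "'a::{real_inner, complete_space} \<Rightarrow> real"
  assumes "bounded_linear f"
  shows "\<exists>z. \<forall>x. f x = inner z x"
proof (cases "\<forall>x. f x = 0")
  case True
  then show ?thesis by (intro exI[of _ 0]) simp
next
  case False
  interpret f: bounded_linear f by fact
  define S where "S = {x. f x = 1}"
  define d where "d = (INF x\<in>S. norm x)"
  obtain x0 where "f x0 \<noteq> 0" using False by blast
  then have S0: "(1 / f x0) *\<^sub>R x0 \<in> S" by (simp add: S_def f.scaleR)
  have bdd: "bdd_below (norm ` S)" by (rule bdd_belowI[of _ 0]) auto
  have dle: "d \<le> norm x" if "x \<in> S" for x
    unfolding d_def using bdd that by (rule cINF_lower)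
  have d0: "d \<ge> 0" unfolding d_def using S0 by (intro cINF_greatest) auto
  have ex: "\<exists>x\<in>S. norm x < d + 1 / real (Suc n)" for n
    using cINF_less_iff[OF _ bdd, of "d + 1 / real (Suc n)"] S0 unfolding d_def by auto
  then obtain X where X: "\<And>n. X n \<in> S" "\<And>n. norm (X n) < d + 1 / real (Suc n)"
    by metis
  have normlim: "(\<lambda>n. norm (X n)) \<longlonglongrightarrow> d"
  proof (rule tendsto_sandwich[of "\<lambda>_. d" _ _ "\<lambda>n. d + 1 / real (Suc n)"])
    show "(\<lambda>n. d + 1 / real (Suc n)) \<longlonglongrightarrow> d"
      using tendsto_add[OF tendsto_const LIMSEQ_Suc[OF lim_1_over_n], of d] by simp
  qed (use X dle less_imp_le[OF X(2)] in \<open>simp_all add: eventually_sequentially\<close>)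
  \<comment> \<open>Midpoints of \<open>S\<close> lie in \<open>S\<close>, which bounds the other diagonal of the parallelogram.\<close>
  have par: "(norm (x - y))\<^sup>2 \<le> 2 * (norm x)\<^sup>2 + 2 * (norm y)\<^sup>2 - 4 * d\<^sup>2" if "x \<in> S" "y \<in> S" for x y
  proof -
    have "(1/2) *\<^sub>R (x + y) \<in> S" using that by (simp add: S_def f.scaleR f.add)
    from dle[OF this] have "2 * d \<le> norm (x + y)" by simp
    then have "(2 * d)\<^sup>2 \<le> (norm (x + y))\<^sup>2" using d0 by (intro power_mono) auto
    then show ?thesis
      by (simp add: power2_norm_eq_inner inner_diff inner_add inner_commute algebra_simps)
  qed
  have "Cauchy X"
  proof (rule CauchyI)
    fix e :: real assume "e > 0"
    have "(\<lambda>n. (norm (X n))\<^sup>2) \<longlonglongrightarrow> d\<^sup>2" by (intro tendsto_power normlim)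
    from order_tendstoD(2)[OF this, of "d\<^sup>2 + e\<^sup>2 / 4"] \<open>e > 0\<close>
    obtain N where N: "\<And>n. n \<ge> N \<Longrightarrow> (norm (X n))\<^sup>2 < d\<^sup>2 + e\<^sup>2 / 4"
      by (auto simp: eventually_sequentially)
    have "norm (X m - X n) < e" if "m \<ge> N" "n \<ge> N" for m n
    proof -
      have "(norm (X m - X n))\<^sup>2 < e\<^sup>2"
        using par[OF X(1) X(1), of m n] N[OF that(1)] N[OF that(2)] by simp
      then show ?thesis using \<open>e > 0\<close> by (simp add: power2_less_imp_less)
    qed
    then show "\<exists>M. \<forall>m\<ge>M. \<forall>n\<ge>M. norm (X m - X n) < e" by blast
  qed
  then obtain w where w: "X \<longlonglongrightarrow> w" by (auto simp: Cauchy_convergent_iff convergent_def)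
  have fw: "f w = 1"
    using LIMSEQ_unique[OF f.tendsto[OF w], of 1] X(1) by (simp add: S_def)
  have nw: "norm w = d" using LIMSEQ_unique[OF tendsto_norm[OF w] normlim] .
  have orth: "inner w k = 0" if k: "f k = 0" for k
  proof (cases "k = 0")
    case False
    define t where "t = inner w k / (norm k)\<^sup>2"
    have "w - t *\<^sub>R k \<in> S" by (simp add: S_def f.diff f.scaleR fw k)
    from dle[OF this] nw have "norm w \<le> norm (w - t *\<^sub>R k)" by simp
    then have "(norm w)\<^sup>2 \<le> (norm (w - t *\<^sub>R k))\<^sup>2" by (intro power_mono) auto
    also have "\<dots> = (norm w)\<^sup>2 - 2 * t * inner w k + t\<^sup>2 * (norm k)\<^sup>2"
      unfolding power2_norm_eq_inner
      by (simp add: inner_diff_left inner_diff_right inner_commute[of k w] power2_eq_square[of t]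
          algebra_simps)
    also have "\<dots> = (norm w)\<^sup>2 - (inner w k)\<^sup>2 / (norm k)\<^sup>2"
      using False by (simp add: t_def power2_eq_square field_simps)
    finally have "(inner w k)\<^sup>2 / (norm k)\<^sup>2 \<le> 0" by simp
    then show ?thesis using False by (simp add: divide_le_0_iff)
  qed simp
  have ww: "inner w w \<noteq> 0" using fw f.zero by auto
  have wx: "inner w x = f x * inner w w" for x
    using orth[of "x - f x *\<^sub>R w"] by (simp add: f.diff f.scaleR fw inner_diff)
  have "f x = inner ((1 / inner w w) *\<^sub>R w) x" for x
    unfolding inner_scaleR_left wx[of x] using ww by simp
  then show ?thesis by blast
qed

text \<open>
  The Riesz theorem sees only real parts; imaginary parts follow by evaluating at \<open>\<i> y\<close>.
\<close>

lemma bounded_form_operator: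
  fixes B :: "'h::chilbert_space \<Rightarrow> 'h \<Rightarrow> complex"
  assumes add_l: "\<And>x x' y. B (x + x') y = B x y + B x' y"
    and sc_l: "\<And>c x y. B (c *\<^sub>C x) y = c * B x y"
    and add_r: "\<And>x y y'. B x (y + y') = B x y + B x y'"
    and sc_r: "\<And>c x y. B x (c *\<^sub>C y) = cnj c * B x y"
    and bd: "\<And>x y. cmod (B x y) \<le> C * norm x * norm y"
  shows "\<exists>T\<in>bops. \<forall>x y. cinner (T x) y = B x y"
proof -
  have "\<exists>z. \<forall>y. cinner z y = B x y" for x
  proof -
    have "bounded_linear (\<lambda>y. Re (B x y))"
    proof (rule bounded_linear_intro[where K = "C * norm x"])
      show "Re (B x (r *\<^sub>R y)) = r *\<^sub>R Re (B x y)" for r y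
        by (simp add: scaleC_of_real[symmetric] sc_r)
      show "norm (Re (B x y)) \<le> norm y * (C * norm x)" for y
        using order_trans[OF abs_Re_le_cmod bd, of x y] by (simp add: mult_ac)
    qed (simp add: add_r)
    from riesz_real[OF this] obtain z where z: "\<And>y. Re (B x y) = inner z y" by blast
    have "cinner z y = B x y" for y
    proof (rule complex_eqI)
      show "Re (cinner z y) = Re (B x y)" by (simp add: Re_cinner z)
      show "Im (cinner z y) = Im (B x y)"
        using z[of "\<i> *\<^sub>C y"] by (simp add: Re_cinner[symmetric] cinner_scaleC_right sc_r)
    qed
    then show ?thesis by blast
  qed
  then obtain T where T: "\<And>x y. cinner (T x) y = B x y" by metis
  have bl: "bounded_linear T"
  proof (rule bounded_linear_intro[where K = "\<bar>C\<bar>"])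
    show "T (x + y) = T x + T y" for x y
      by (rule cinner_ext) (simp add: T cinner_add_left add_l)
    show "T (r *\<^sub>R x) = r *\<^sub>R T x" for r x
      by (rule cinner_ext) (simp add: T scaleC_of_real[symmetric] cinner_scaleC_left sc_l)
    show "norm (T x) \<le> norm x * \<bar>C\<bar>" for x
    proof (cases "T x = 0")
      case False
      have "norm (T x) * norm (T x) = cmod (B x (T x))"
        unfolding T[symmetric] cinner_self by (simp add: power2_eq_square norm_mult)
      also have "\<dots> \<le> C * norm x * norm (T x)" by (rule bd)
      also have "\<dots> \<le> \<bar>C\<bar> * norm x * norm (T x)" by (intro mult_right_mono) auto
      finally show ?thesis using False by (simp add: mult.commute)
    qed simp
  qed
  have "T (c *\<^sub>C x) = c *\<^sub>C T x" for c x
    by (rule cinner_ext) (simp add: T cinner_scaleC_left sc_l)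
  with bl T show ?thesis
    by (intro bexI[of _ "Blinfun T"]) (auto simp: bops_def bounded_linear_Blinfun_apply)
qed

section \<open>Adjoints\<close>

lemma bops_scaleC: "a \<in> bops \<Longrightarrow> blinfun_apply a (c *\<^sub>C x) = c *\<^sub>C blinfun_apply a x"
  by (simp add: bops_def)

lemma adj_exists:
  fixes T :: "'h::chilbert_space \<Rightarrow>\<^sub>L 'h"
  assumes "T \<in> bops"
  shows "\<exists>S\<in>bops. \<forall>x y. cinner (T x) y = cinner x (S y)"
proof -
  have "\<exists>S\<in>bops. \<forall>x y. cinner (blinfun_apply S x) y = cinner x (T y)"
  proof (rule bounded_form_operator[where C = "norm T"])
    show "cmod (cinner x (T y)) \<le> norm T * norm x * norm y" for x y
    proof -
      have "cmod (cinner x (T y)) \<le> norm x * norm (T y)" by (rule norm_cinner_le)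
      also have "\<dots> \<le> norm x * (norm T * norm y)" by (intro mult_left_mono norm_blinfun) auto
      finally show ?thesis by (simp add: mult_ac)
    qed
  qed (simp_all add: cinner_add_left cinner_scaleC_left cinner_scaleC_right cinner_add_right
      blinfun.add_right bops_scaleC[OF assms])
  then show ?thesis by (metis cinner_commute)
qed

lemma cinner_adj_unique:
  fixes T S S' :: "'h::chilbert_space \<Rightarrow>\<^sub>L 'h"
  assumes "\<And>x y. cinner (T x) y = cinner x (S y)" "\<And>x y. cinner (T x) y = cinner x (S' y)"
  shows "S = S'"
  by (rule blinfun_cinner_ext) (metis assms cinner_commute)

lemma adj_eqI:
  fixes T S :: "'h::chilbert_space \<Rightarrow>\<^sub>L 'h"
  assumes "\<And>x y. cinner (T x) y = cinner x (S y)"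
  shows "adj T = S"
  unfolding adj_def using assms cinner_adj_unique by (intro the_equality) blast+

lemma cinner_adj_right: "T \<in> bops \<Longrightarrow> cinner x (blinfun_apply (adj T) y) = cinner (blinfun_apply T x) y"
  for T :: "'h::chilbert_space \<Rightarrow>\<^sub>L 'h"
  using adj_exists[of T] adj_eqI by metis

lemma cinner_adj_left:
  fixes T :: "'h::chilbert_space \<Rightarrow>\<^sub>L 'h"
  shows "T \<in> bops \<Longrightarrow> cinner (adj T x) y = cinner x (T y)"
  by (metis cinner_adj_right cinner_commute)

lemma adj_adj: "T \<in> bops \<Longrightarrow> adj (adj T) = T"
  for T :: "'h::chilbert_space \<Rightarrow>\<^sub>L 'h"
  by (rule adj_eqI) (simp add: cinner_adj_left)

lemma adj_compose:
  fixes S T :: "'h::chilbert_space \<Rightarrow>\<^sub>L 'h"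
  shows "S \<in> bops \<Longrightarrow> T \<in> bops \<Longrightarrow> adj (S o\<^sub>L T) = adj T o\<^sub>L adj S"
  by (rule adj_eqI) (simp add: cinner_adj_right)

section \<open>The ultraweak topology\<close>

lemma summable_cinner_bound:
  fixes x y :: "nat \<Rightarrow> 'h::chilbert_space"
  assumes "summable (\<lambda>n. (norm (x n))\<^sup>2)" "summable (\<lambda>n. (norm (y n))\<^sup>2)"
  shows "summable (\<lambda>n. norm (x n) * norm (y n))"
proof (rule summable_comparison_test)
  show "summable (\<lambda>n. (norm (x n))\<^sup>2 + (norm (y n))\<^sup>2)" using assms by (rule summable_add)
  have "norm (x n) * norm (y n) \<le> (norm (x n))\<^sup>2 + (norm (y n))\<^sup>2" for n
    using sum_squares_bound[of "norm (x n)" "norm (y n)"]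
      mult_nonneg_nonneg[OF norm_ge_zero norm_ge_zero, of "x n" "y n"] by linarith
  then show "\<exists>N. \<forall>n\<ge>N. norm (norm (x n) * norm (y n)) \<le> (norm (x n))\<^sup>2 + (norm (y n))\<^sup>2"
    by auto
qed

definition wstar_subbase :: "('h::chilbert_space \<Rightarrow>\<^sub>L 'h) set set" where
  "wstar_subbase = {{T :: 'h \<Rightarrow>\<^sub>L 'h. (\<Sum>n. cinner (T (x n)) (y n)) \<in> U} | x y U.
     summable (\<lambda>n::nat. (norm (x n))\<^sup>2) \<and> summable (\<lambda>n. (norm (y n))\<^sup>2) \<and> open U}"

lemma wstar_eq: "wstar = subtopology (topology_generated_by wstar_subbase) bops"
  by (simp add: wstar_def wstar_subbase_def)

lemma Union_wstar_subbase: "\<Union>wstar_subbase = (UNIV :: ('h::chilbert_space \<Rightarrow>\<^sub>L 'h) set)"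
proof -
  have "UNIV \<in> (wstar_subbase :: ('h \<Rightarrow>\<^sub>L 'h) set set)"
    unfolding wstar_subbase_def
    by (intro CollectI exI[of _ "\<lambda>_. 0"] exI[of _ UNIV]) simp
  then show ?thesis by blast
qed

lemma topspace_wstar: "topspace (wstar :: ('h::chilbert_space \<Rightarrow>\<^sub>L 'h) topology) = bops"
  by (simp add: wstar_eq Union_wstar_subbase topology_generated_by_topspace)

text \<open>
  A matrix coefficient is an ultraweak functional, with two sequences of vectors that vanish beyond
  index \<open>0\<close>.
\<close>

lemma continuous_map_wstar_coefficient:
  "continuous_map wstar euclidean (\<lambda>T :: 'h::chilbert_space \<Rightarrow>\<^sub>L 'h. cinner (T x) y)"
proof -
  define X Y where "X = (\<lambda>n::nat. if n = 0 then x else 0)" and "Y = (\<lambda>n::nat. if n = 0 then y else 0)"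
  have eq: "(\<Sum>n. cinner (blinfun_apply T (X n)) (Y n)) = cinner (blinfun_apply T x) y"
    for T :: "'h \<Rightarrow>\<^sub>L 'h"
    by (subst suminf_finite[of "{0}"]) (auto simp: X_def Y_def cinner.zero_left)
  have S: "summable (\<lambda>n. (norm (X n))\<^sup>2)" "summable (\<lambda>n. (norm (Y n))\<^sup>2)"
    by (rule summable_finite[of "{0}"]; simp add: X_def Y_def)+
  have "openin (topology_generated_by wstar_subbase) {T :: 'h \<Rightarrow>\<^sub>L 'h. cinner (T x) y \<in> U}"
    if "open U" for U
    using that S unfolding wstar_subbase_def
    by (intro topology_generated_by_Basis CollectI exI[of _ X] exI[of _ Y] exI[of _ U]) (simp add: eq)
  then show ?thesis
    unfolding wstar_eq
    by (intro continuous_map_from_subtopology)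
      (auto simp: continuous_map_def topology_generated_by_topspace Union_wstar_subbase)
qed

lemma Hausdorff_space_wstar: "Hausdorff_space (wstar :: ('h::chilbert_space \<Rightarrow>\<^sub>L 'h) topology)"
  unfolding Hausdorff_space_def
proof (intro allI impI, elim conjE)
  fix S T :: "'h \<Rightarrow>\<^sub>L 'h"
  assume ST: "S \<in> topspace wstar" "T \<in> topspace wstar" "S \<noteq> T"
  then obtain x y where "cinner (S x) y \<noteq> cinner (T x) y"
    using blinfun_cinner_ext by metis
  then obtain U V where UV: "open U" "open V" "cinner (S x) y \<in> U" "cinner (T x) y \<in> V" "U \<inter> V = {}"
    using hausdorff by metis
  let ?P = "\<lambda>W. {R \<in> topspace wstar. cinner (blinfun_apply R x) y \<in> W}"
  have "openin wstar (?P U)" "openin wstar (?P V)"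
    using UV continuous_map_wstar_coefficient by (auto intro!: openin_continuous_map_preimage)
  moreover have "S \<in> ?P U" "T \<in> ?P V" "disjnt (?P U) (?P V)"
    using ST UV by (auto simp: disjnt_def)
  ultimately show "\<exists>U V. openin wstar U \<and> openin wstar V \<and> S \<in> U \<and> T \<in> V \<and> disjnt U V" by blast
qed

lemma limitin_topology_generated_by:
  assumes l: "l \<in> topspace (topology_generated_by G)"
    and ev: "\<And>U. U \<in> G \<Longrightarrow> l \<in> U \<Longrightarrow> eventually (\<lambda>i. f i \<in> U) F"
  shows "limitin (topology_generated_by G) f l F"
  unfolding limitin_def
proof (intro conjI l allI impI, elim conjE)
  fix U assume "openin (topology_generated_by G) U" "l \<in> U"
  then have "generate_topology_on G U" "l \<in> U" by (auto dest: openin_topology_generated_by)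
  then show "eventually (\<lambda>i. f i \<in> U) F"
  proof (induction U)
    case (Int a b)
    then show ?case by (auto intro: eventually_conj)
  next
    case (UN K)
    then obtain k where k: "k \<in> K" "l \<in> k" by blast
    show ?case by (rule eventually_mono[OF UN.IH[OF k]]) (use k in blast)
  qed (use ev in auto)
qed

text \<open>
  On norm-bounded nets the weak operator topology and the ultraweak topology agree: the series
  defining an ultraweak functional is dominated uniformly along the net.
\<close>

lemma limitin_wstar_bounded:
  fixes T :: "'i \<Rightarrow> ('h::chilbert_space \<Rightarrow>\<^sub>L 'h)" and L :: "'h \<Rightarrow>\<^sub>L 'h"
  assumes "F \<noteq> bot" "L \<in> bops" "\<And>i. T i \<in> bops" and bd: "\<And>i. norm (T i) \<le> C"
    and lim: "\<And>x y. ((\<lambda>i. cinner (T i x) y) \<longlongrightarrow> cinner (L x) y) F"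
  shows "limitin wstar T L F"
  unfolding wstar_eq limitin_subtopology
proof (intro conjI limitin_topology_generated_by)
  show "L \<in> topspace (topology_generated_by wstar_subbase)"
    by (simp add: topology_generated_by_topspace Union_wstar_subbase)
  fix W :: "('h \<Rightarrow>\<^sub>L 'h) set" assume "W \<in> wstar_subbase" "L \<in> W"
  then obtain x y U where W: "W = {T :: 'h \<Rightarrow>\<^sub>L 'h. (\<Sum>n. cinner (T (x n)) (y n)) \<in> U}"
    and s: "summable (\<lambda>n::nat. (norm (x n :: 'h))\<^sup>2)" "summable (\<lambda>n. (norm (y n :: 'h))\<^sup>2)" and "open U"
    unfolding wstar_subbase_def by blast
  have "((\<lambda>i. \<Sum>n. cinner (T i (x n)) (y n)) \<longlongrightarrow> (\<Sum>n. cinner (L (x n)) (y n))) F"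
  proof (rule tannerys_theorem[where M = "\<lambda>n. C * (norm (x n) * norm (y n))", THEN conjunct2, THEN conjunct2])
    show "summable (\<lambda>n. C * (norm (x n) * norm (y n)))"
      by (intro summable_mult summable_cinner_bound s)
    have "norm (cinner (T i (x n)) (y n)) \<le> C * (norm (x n) * norm (y n))" for n i
    proof -
      have "norm (T i (x n)) \<le> C * norm (x n)"
        using norm_blinfun[of "T i" "x n"] bd[of i]
        by (meson mult_right_mono norm_ge_zero order_trans)
      then have "norm (T i (x n)) * norm (y n) \<le> C * norm (x n) * norm (y n)"
        by (rule mult_right_mono) simp
      with norm_cinner_le[of "T i (x n)" "y n"] show ?thesis by (simp add: mult_ac)
    qed
    then show "\<forall>\<^sub>F (n, i) in sequentially \<times>\<^sub>F F. norm (cinner (T i (x n)) (y n)) \<le> C * (norm (x n) * norm (y n))"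
      by (intro always_eventually) auto
  qed (use lim \<open>F \<noteq> bot\<close> in auto)
  then show "\<forall>\<^sub>F i in F. T i \<in> W"
    using \<open>open U\<close> \<open>L \<in> W\<close> unfolding W by (auto dest: topological_tendstoD)
qed (use assms in auto)

section \<open>Operator algebras and operator matrices\<close>

lemma blinfun_apply_scale_op [simp]:
  "blinfun_apply (scale_op c a) x = c *\<^sub>C blinfun_apply a x"
  by (simp add: scale_op.rep_eq)

lemma scale_op_of_real: "scale_op (complex_of_real r) a = r *\<^sub>R a"
  by (rule blinfun_eqI) (simp add: scaleC_of_real blinfun.scaleR_left)

lemma
  assumes "von_neumann_algebra M"
  shows vna_bops: "a \<in> M \<Longrightarrow> a \<in> bops"
    and vna_id: "id_blinfun \<in> M"
    and vna_add: "a \<in> M \<Longrightarrow> b \<in> M \<Longrightarrow> a + b \<in> M"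
    and vna_scale: "a \<in> M \<Longrightarrow> scale_op c a \<in> M"
    and vna_compose: "a \<in> M \<Longrightarrow> b \<in> M \<Longrightarrow> a o\<^sub>L b \<in> M"
    and vna_adj: "a \<in> M \<Longrightarrow> adj a \<in> M"
    and vna_closed: "closedin wstar M"
  using assms by (auto simp: von_neumann_algebra_def mult_stable_def)

lemma vna_scaleR: "von_neumann_algebra M \<Longrightarrow> a \<in> M \<Longrightarrow> r *\<^sub>R a \<in> M"
  using vna_scale[of M a "complex_of_real r"] by (simp add: scale_op_of_real)

lemma vna_zero: "von_neumann_algebra M \<Longrightarrow> 0 \<in> M"
  using vna_scaleR[OF _ vna_id, of M 0] by simp

lemma vna_sum: "von_neumann_algebra M \<Longrightarrow> (\<And>i. i \<in> I \<Longrightarrow> a i \<in> M) \<Longrightarrow> sum a I \<in> M"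
  by (induction I rule: infinite_finite_induct) (auto simp: vna_zero vna_add)

lemma positive_mat_iff:
  "positive_mat n A \<longleftrightarrow>
     (\<forall>x. (\<Sum>i<n. \<Sum>j<n. cinner (blinfun_apply (A i j) (x j)) (x i)) \<in> \<real>\<^sub>\<ge>\<^sub>0)"
  by (simp add: positive_mat_def mat_apply_def cinner.sum_left)

lemma positive_mat_gram:
  fixes X :: "nat \<Rightarrow> ('h::chilbert_space \<Rightarrow>\<^sub>L 'h)"
  assumes "\<And>i. X i \<in> bops"
  shows "positive_mat n (\<lambda>i j. adj (X i) o\<^sub>L X j)"
  unfolding positive_mat_iff
proof
  fix x
  have "(\<Sum>i<n. \<Sum>j<n. cinner ((adj (X i) o\<^sub>L X j) (x j)) (x i)) =
      cinner (\<Sum>j<n. X j (x j)) (\<Sum>i<n. X i (x i))"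
    using assms by (simp add: cinner_adj_left cinner.sum_left cinner.sum_right)
  then show "(\<Sum>i<n. \<Sum>j<n. cinner ((adj (X i) o\<^sub>L X j) (x j)) (x i)) \<in> \<real>\<^sub>\<ge>\<^sub>0"
    by (simp add: cinner_self)
qed

text \<open>
  The operator matrix with block rows \<open>(c, P)\<close> and \<open>(Q, c)\<close>, the blocks having size \<open>n \<times> n\<close>.
\<close>

definition block_mat ::
    "nat \<Rightarrow> real \<Rightarrow> (nat \<Rightarrow> nat \<Rightarrow> ('h::chilbert_space \<Rightarrow>\<^sub>L 'h)) \<Rightarrow>
     (nat \<Rightarrow> nat \<Rightarrow> ('h \<Rightarrow>\<^sub>L 'h)) \<Rightarrow> nat \<Rightarrow> nat \<Rightarrow> ('h \<Rightarrow>\<^sub>L 'h)" where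
  "block_mat n c P Q i j =
     (if i < n \<longleftrightarrow> j < n then (if i = j then c *\<^sub>R id_blinfun else 0)
      else if i < n then P i (j - n) else Q (i - n) j)"

lemma sum_lessThan_double:
  "(\<Sum>i<n + n. f i) = (\<Sum>i<n. f i) + (\<Sum>i<n. f (n + i))"
  for f :: "nat \<Rightarrow> 'b::comm_monoid_add"
proof -
  have "(\<Sum>i<n + m. f i) = (\<Sum>i<n. f i) + (\<Sum>i<m. f (n + i))" for m
    by (induction m) (auto simp: add.assoc)
  then show ?thesis .
qed

lemma positive_block_mat_iff:
  "positive_mat (n + n) (block_mat n c P Q) \<longleftrightarrow>
    (\<forall>x y. complex_of_real (c * (\<Sum>i<n. (norm (x i))\<^sup>2))
        + (\<Sum>i<n. \<Sum>j<n. cinner (blinfun_apply (P i j) (y j)) (x i))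
        + (\<Sum>i<n. \<Sum>j<n. cinner (blinfun_apply (Q i j) (x j)) (y i))
        + complex_of_real (c * (\<Sum>i<n. (norm (y i))\<^sup>2)) \<in> \<real>\<^sub>\<ge>\<^sub>0)" (is "_ \<longleftrightarrow> (\<forall>x y. ?R x y \<in> _)")
proof -
  have diag: "(\<Sum>j<n. cinner (blinfun_apply (if i = j then c *\<^sub>R id_blinfun else 0) (u j)) (u i))
      = complex_of_real (c * (norm (u i))\<^sup>2)" if "i < n" for u :: "nat \<Rightarrow> 'a" and i
  proof -
    have "(\<Sum>j<n. cinner (blinfun_apply (if i = j then c *\<^sub>R id_blinfun else 0) (u j)) (u i))
        = (\<Sum>j<n. if i = j then complex_of_real (c * (norm (u i))\<^sup>2) else 0)"
      by (intro sum.cong) (auto simp: blinfun.scaleR_left cinner.scaleR_left cinner_self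
          scaleR_conv_of_real cinner.zero_left)
    then show ?thesis using that by simp
  qed
  have form: "(\<Sum>i<n + n. \<Sum>j<n + n. cinner (blinfun_apply (block_mat n c P Q i j) (z j)) (z i))
      = ?R z (\<lambda>i. z (n + i))" for z
    unfolding sum_lessThan_double block_mat_def
    by (simp add: sum.distrib diag[of _ z] diag[of _ "\<lambda>i. z (n + i)"] sum_distrib_left)
  show ?thesis
  proof
    assume L: "positive_mat (n + n) (block_mat n c P Q)"
    show "\<forall>x y. ?R x y \<in> \<real>\<^sub>\<ge>\<^sub>0"
    proof (intro allI)
      fix x y :: "nat \<Rightarrow> 'a"
      define z where "z = (\<lambda>i. if i < n then x i else y (i - n))"
      have "?R z (\<lambda>i. z (n + i)) \<in> \<real>\<^sub>\<ge>\<^sub>0"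
        using L unfolding positive_mat_iff form by blast
      then show "?R x y \<in> \<real>\<^sub>\<ge>\<^sub>0" by (simp add: z_def)
    qed
  next
    assume R: "\<forall>x y. ?R x y \<in> \<real>\<^sub>\<ge>\<^sub>0"
    show "positive_mat (n + n) (block_mat n c P Q)"
      unfolding positive_mat_iff form by (intro allI R[rule_format])
  qed
qed

section \<open>Unital completely positive maps\<close>

context
  fixes M :: "('h::chilbert_space \<Rightarrow>\<^sub>L 'h) set" and f :: "('h \<Rightarrow>\<^sub>L 'h) \<Rightarrow> ('h \<Rightarrow>\<^sub>L 'h)"
  assumes vna: "von_neumann_algebra M" and cp: "completely_positive M f"
    and unital: "f id_blinfun = id_blinfun"
begin

lemma cp_closed: "a \<in> M \<Longrightarrow> f a \<in> M"
  and cp_add: "a \<in> M \<Longrightarrow> b \<in> M \<Longrightarrow> f (a + b) = f a + f b"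
  and cp_scale: "a \<in> M \<Longrightarrow> f (scale_op c a) = scale_op c (f a)"
  and cp_positive: "(\<And>i j. i < n \<Longrightarrow> j < n \<Longrightarrow> A i j \<in> M) \<Longrightarrow> positive_mat n A \<Longrightarrow>
    positive_mat n (\<lambda>i j. f (A i j))"
  using cp by (auto simp: completely_positive_def linear_selfmap_def)

lemma cp_scaleR: "a \<in> M \<Longrightarrow> f (r *\<^sub>R a) = r *\<^sub>R f a"
  using cp_scale[of a "complex_of_real r"] by (simp add: scale_op_of_real)

lemma cp_zero: "f 0 = 0"
  using cp_scaleR[OF vna_id[OF vna], of 0] by simp

lemma cp_bops: "a \<in> M \<Longrightarrow> f a \<in> bops"
  by (rule vna_bops[OF vna cp_closed])

lemma cp_sum: "(\<And>i. i \<in> I \<Longrightarrow> a i \<in> M) \<Longrightarrow> f (sum a I) = (\<Sum>i\<in>I. f (a i))"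
  by (induction I rule: infinite_finite_induct)
    (auto simp: cp_zero cp_add vna_sum[OF vna])

text \<open>
  If \<open>c\<close> bounds the operator matrix \<open>A\<close>, the self-adjoint block matrix with diagonal \<open>c\<close> and
  off-diagonal blocks \<open>A\<close> and its adjoint is positive, and a completely positive map preserves
  this. Compatibility with adjoints, contractivity and complete contractivity all come from this.
\<close>

lemma cp_block_positive:
  assumes A: "\<And>i j. A i j \<in> M" and c: "c \<ge> 0"
    and bd: "\<And>y. L2_set (\<lambda>i. norm (mat_apply n A y i)) {..<n} \<le> c * L2_set (\<lambda>i. norm (y i)) {..<n}"
  shows "positive_mat (n + n) (block_mat n c (\<lambda>i j. f (A i j)) (\<lambda>i j. f (adj (A j i))))"
proof -
  have "positive_mat (n + n) (block_mat n c A (\<lambda>i j. adj (A j i)))"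
    unfolding positive_block_mat_iff
  proof (intro allI)
    fix x y :: "nat \<Rightarrow> 'h"
    let ?x = "L2_set (\<lambda>i. norm (x i)) {..<n}" and ?y = "L2_set (\<lambda>i. norm (y i)) {..<n}"
    define S where "S = (\<Sum>i<n. \<Sum>j<n. cinner (A i j (y j)) (x i))"
    have "(\<Sum>i<n. \<Sum>j<n. cinner (adj (A j i) (x j)) (y i)) =
        (\<Sum>i<n. \<Sum>j<n. cnj (cinner (A j i (y i)) (x j)))"
      by (intro sum.cong refl) (metis cinner_adj_left[OF vna_bops[OF vna A]] cinner_commute)
    also have "\<dots> = cnj S" unfolding S_def cnj_sum by (rule sum.swap)
    finally have adj: "(\<Sum>i<n. \<Sum>j<n. cinner (adj (A j i) (x j)) (y i)) = cnj S" .
    have "S = (\<Sum>i<n. cinner (mat_apply n A y i) (x i))"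
      by (simp add: S_def mat_apply_def cinner.sum_left)
    then have "cmod S \<le> (\<Sum>i<n. cmod (cinner (mat_apply n A y i) (x i)))"
      by (simp add: norm_sum)
    also have "\<dots> \<le> (\<Sum>i<n. \<bar>norm (mat_apply n A y i)\<bar> * \<bar>norm (x i)\<bar>)"
      by (intro sum_mono) (simp add: norm_cinner_le)
    also have "\<dots> \<le> L2_set (\<lambda>i. norm (mat_apply n A y i)) {..<n} * ?x"
      by (rule L2_set_mult_ineq)
    also have "\<dots> \<le> c * ?y * ?x" by (intro mult_right_mono bd) simp
    finally have "cmod S \<le> c * ?y * ?x" .
    then have "- Re S \<le> c * (?y * ?x)"
      using abs_Re_le_cmod[of S] by (simp add: mult.assoc)
    moreover have "2 * (c * (?y * ?x)) \<le> c * (?x)\<^sup>2 + c * (?y)\<^sup>2"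
      using mult_left_mono[OF sum_squares_bound[of ?x ?y] c] by (simp add: algebra_simps)
    ultimately have "0 \<le> c * (?x)\<^sup>2 + 2 * Re S + c * (?y)\<^sup>2" by linarith
    moreover have "(?x)\<^sup>2 = (\<Sum>i<n. (norm (x i))\<^sup>2)" "(?y)\<^sup>2 = (\<Sum>i<n. (norm (y i))\<^sup>2)"
      by (simp_all add: L2_set_def sum_nonneg)
    ultimately have "0 \<le> c * (\<Sum>i<n. (norm (x i))\<^sup>2) + 2 * Re S + c * (\<Sum>i<n. (norm (y i))\<^sup>2)"
      by simp
    then show "complex_of_real (c * (\<Sum>i<n. (norm (x i))\<^sup>2))
        + (\<Sum>i<n. \<Sum>j<n. cinner (A i j (y j)) (x i))
        + (\<Sum>i<n. \<Sum>j<n. cinner (adj (A j i) (x j)) (y i))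
        + complex_of_real (c * (\<Sum>i<n. (norm (y i))\<^sup>2)) \<in> \<real>\<^sub>\<ge>\<^sub>0"
      unfolding adj S_def[symmetric] by (simp add: complex_nonneg_Reals_iff)
  qed
  then have "positive_mat (n + n) (\<lambda>i j. f (block_mat n c A (\<lambda>i j. adj (A j i)) i j))"
    by (rule cp_positive[rotated]) (auto simp: block_mat_def A vna_adj[OF vna] vna_zero[OF vna]
        vna_scaleR[OF vna] vna_id[OF vna])
  moreover have "(\<lambda>i j. f (block_mat n c A (\<lambda>i j. adj (A j i)) i j)) =
      block_mat n c (\<lambda>i j. f (A i j)) (\<lambda>i j. f (adj (A j i)))"
    by (intro ext) (simp add: block_mat_def cp_zero cp_scaleR vna_id[OF vna] unital)
  ultimately show ?thesis by simp
qed

text \<open>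
  A positive matrix is Hermitian, so its off-diagonal entries are adjoint to each other.
\<close>

lemma cp_adj:
  assumes a: "a \<in> M"
  shows "f (adj a) = adj (f a)"
proof (rule adj_eqI[symmetric])
  have pos: "complex_of_real (norm a * (norm x)\<^sup>2) + cinner (f a y) x + cinner (f (adj a) x) y
      + complex_of_real (norm a * (norm y)\<^sup>2) \<in> \<real>\<^sub>\<ge>\<^sub>0" for x y
  proof -
    have "positive_mat (1 + 1) (block_mat 1 (norm a) (\<lambda>i j. f a) (\<lambda>i j. f (adj a)))"
      by (rule cp_block_positive) (auto simp: a mat_apply_def L2_set_def norm_blinfun)
    then show ?thesis unfolding positive_block_mat_iff
      by (elim allE[of _ "\<lambda>_. x"] allE[of _ "\<lambda>_. y"]) simp
  qed
  have im: "Im (cinner (f a y) x) = - Im (cinner (f (adj a) x) y)" for x y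
    using pos[of x y] by (simp add: complex_nonneg_Reals_iff)
  fix y x
  \<comment> \<open>Replacing \<open>y\<close> by \<open>\<i> y\<close> turns the identity of imaginary parts into one of real parts.\<close>
  have "Re (cinner (f a y) x) = Re (cinner (f (adj a) x) y)"
    using im[of "\<i> *\<^sub>C y" x]
    by (simp add: bops_scaleC[OF cp_bops[OF a]] cinner_scaleC_left cinner_scaleC_right)
  with im[of y x] have "cinner (f a y) x = cnj (cinner (f (adj a) x) y)"
    by (simp add: complex_eq_iff)
  then show "cinner (f a y) x = cinner y (f (adj a) x)"
    by (metis cinner_commute)
qed

text \<open>
  Evaluating the positive block form at the pair \<open>(- u w, v y)\<close>, where \<open>w\<close> is the image of \<open>y\<close> under
  the matrix with entries \<open>f (A i j)\<close>, makes both cross terms equal to \<open>- u v \<parallel>w\<parallel>\<^sup>2\<close>.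
\<close>

lemma cp_matrix_bound:
  assumes A: "\<And>i j. A i j \<in> M" and c: "c \<ge> 0"
    and bd: "\<And>y. L2_set (\<lambda>i. norm (mat_apply n A y i)) {..<n} \<le> c * L2_set (\<lambda>i. norm (y i)) {..<n}"
  shows "L2_set (\<lambda>i. norm (mat_apply n (\<lambda>i j. f (A i j)) y i)) {..<n} \<le>
    c * L2_set (\<lambda>i. norm (y i)) {..<n}" (is "?w \<le> c * ?y")
proof -
  define w where "w = mat_apply n (\<lambda>i j. f (A i j)) y"
  have L2: "(L2_set (\<lambda>i. norm (z i)) {..<n})\<^sup>2 = (\<Sum>i<n. (norm (z i))\<^sup>2)" for z :: "nat \<Rightarrow> 'h"
    by (simp add: L2_set_def sum_nonneg)
  have w1: "(\<Sum>i<n. \<Sum>j<n. cinner (f (A i j) (y j)) (w i)) = complex_of_real (?w\<^sup>2)"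
  proof -
    have "(\<Sum>j<n. cinner (f (A i j) (y j)) (w i)) = complex_of_real ((norm (w i))\<^sup>2)" for i
      unfolding cinner_self[symmetric] by (simp add: w_def mat_apply_def cinner.sum_left)
    then show ?thesis unfolding w_def[symmetric] L2 by simp
  qed
  have w2: "(\<Sum>i<n. \<Sum>j<n. cinner (f (adj (A j i)) (w j)) (y i)) = complex_of_real (?w\<^sup>2)"
  proof -
    have "(\<Sum>i<n. \<Sum>j<n. cinner (f (adj (A j i)) (w j)) (y i)) =
        (\<Sum>i<n. \<Sum>j<n. cnj (cinner (f (A j i) (y i)) (w j)))"
      by (intro sum.cong refl)
        (metis cp_adj[OF A] cinner_adj_left[OF cp_bops[OF A]] cinner_commute)
    also have "\<dots> = cnj (\<Sum>i<n. \<Sum>j<n. cinner (f (A i j) (y j)) (w i))"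
      unfolding cnj_sum by (rule sum.swap)
    finally show ?thesis by (simp add: w1)
  qed
  have "0 \<le> c * (u * ?w)\<^sup>2 + 2 * (u * v) * (- ?w\<^sup>2) + c * (v * ?y)\<^sup>2" for u v
  proof -
    have "complex_of_real (c * (\<Sum>i<n. (norm ((- u) *\<^sub>R w i))\<^sup>2))
        + (\<Sum>i<n. \<Sum>j<n. cinner (f (A i j) (v *\<^sub>R y j)) ((- u) *\<^sub>R w i))
        + (\<Sum>i<n. \<Sum>j<n. cinner (f (adj (A j i)) ((- u) *\<^sub>R w j)) (v *\<^sub>R y i))
        + complex_of_real (c * (\<Sum>i<n. (norm (v *\<^sub>R y i))\<^sup>2)) \<in> \<real>\<^sub>\<ge>\<^sub>0"
      by (rule cp_block_positive[OF A c bd, unfolded positive_block_mat_iff, rule_format])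
    also have "(\<Sum>i<n. \<Sum>j<n. cinner (f (A i j) (v *\<^sub>R y j)) ((- u) *\<^sub>R w i)) =
        complex_of_real (- u * v * ?w\<^sup>2)"
      unfolding of_real_mult w1[symmetric]
      by (simp add: blinfun.scaleR_right cinner.scaleR_left cinner.scaleR_right cinner.minus_right
          scaleR_conv_of_real sum_distrib_left sum_negf mult_ac)
    also have "(\<Sum>i<n. \<Sum>j<n. cinner (f (adj (A j i)) ((- u) *\<^sub>R w j)) (v *\<^sub>R y i)) =
        complex_of_real (- u * v * ?w\<^sup>2)"
      unfolding of_real_mult w2[symmetric]
      by (simp add: blinfun.scaleR_right blinfun.minus_right cinner.scaleR_left cinner.scaleR_right
          cinner.minus_left scaleR_conv_of_real sum_distrib_left sum_negf mult_ac)
    finally have "0 \<le> c * (\<Sum>i<n. (norm ((- u) *\<^sub>R w i))\<^sup>2) - 2 * u * v * ?w\<^sup>2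
        + c * (\<Sum>i<n. (norm (v *\<^sub>R y i))\<^sup>2)"
      by (simp add: complex_nonneg_Reals_iff)
    moreover have "(\<Sum>i<n. (norm (r *\<^sub>R z i))\<^sup>2) = (r * L2_set (\<lambda>i. norm (z i)) {..<n})\<^sup>2"
      for r and z :: "nat \<Rightarrow> 'h"
      by (simp add: power_mult_distrib L2 sum_distrib_left)
    ultimately show ?thesis by (simp add: w_def)
  qed
  then have "- (- ?w\<^sup>2) \<le> c * ?w * ?y" by (rule quadratic_form_bound) (use c in auto)
  then have le: "?w * ?w \<le> ?w * (c * ?y)" by (simp add: power2_eq_square mult_ac)
  show ?thesis
  proof (cases "?w = 0")
    case False
    then have "?w > 0" using L2_set_nonneg by (metis less_eq_real_def)
    with le show ?thesis by (rule mult_left_le_imp_le)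
  qed (use c in simp)
qed

lemma cp_contractive:
  assumes "a \<in> M"
  shows "norm (f a) \<le> norm a"
proof (rule norm_blinfun_bound)
  fix x
  show "norm (f a x) \<le> norm a * norm x"
  proof -
    have "L2_set (\<lambda>i. norm (mat_apply 1 (\<lambda>i j. f a) (\<lambda>_. x) i)) {..<1} \<le>
        norm a * L2_set (\<lambda>_. norm x) {..<1::nat}"
      by (rule cp_matrix_bound) (auto simp: assms mat_apply_def L2_set_def norm_blinfun)
    then show ?thesis by (simp add: mat_apply_def L2_set_def)
  qed
qed simp

text \<open>
  Choi's multiplicative domain: apply positivity of the image of the Gram matrix of \<open>(1, a, b)\<close>
  to the vector \<open>(- (f a \<xi> + f b \<eta>), \<xi>, \<eta>)\<close>. When equality holds in the Kadison--Schwarz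
  inequality for \<open>a\<close>, the part quadratic in \<open>\<xi>\<close> drops out, so the part linear in \<open>\<xi>\<close> vanishes.
\<close>

lemma cp_multiplicative_domain:
  assumes a: "a \<in> M" and b: "b \<in> M" and eq: "f (adj a o\<^sub>L a) = adj (f a) o\<^sub>L f a"
  shows "f (adj a o\<^sub>L b) = adj (f a) o\<^sub>L f b"
proof -
  define X where "X = (\<lambda>i::nat. if i = 0 then id_blinfun else if i = 1 then a else b)"
  have X: "X i \<in> M" for i by (simp add: X_def a b vna_id[OF vna])
  have "positive_mat 3 (\<lambda>i j. adj (X i) o\<^sub>L X j)"
    by (intro positive_mat_gram vna_bops[OF vna] X)
  then have pos: "positive_mat 3 (\<lambda>i j. f (adj (X i) o\<^sub>L X j))"
    by (intro cp_positive) (auto intro: vna_compose[OF vna] vna_adj[OF vna] X)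
  have adj1: "adj (id_blinfun :: 'h \<Rightarrow>\<^sub>L 'h) = id_blinfun" by (rule adj_eqI) simp
  have id: "id_blinfun o\<^sub>L g = g" "g o\<^sub>L id_blinfun = g" for g :: "'h \<Rightarrow>\<^sub>L 'h"
    by (auto intro: blinfun_eqI)
  define D where "D = f (adj a o\<^sub>L b) - (adj (f a) o\<^sub>L f b)"
  have ab: "f (adj b o\<^sub>L a) = adj (f (adj a o\<^sub>L b))"
    by (metis a b adj_adj adj_compose cp_adj vna_adj[OF vna] vna_bops[OF vna] vna_compose[OF vna])
  have inner_zero: "inner (D \<eta>) \<xi> = 0" for \<xi> \<eta>
  proof -
    define k where "k = Re (cinner (f (adj b o\<^sub>L b) \<eta>) \<eta>) - (norm (f b \<eta>))\<^sup>2"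
    \<comment> \<open>An affine function of \<open>u\<close> that is bounded below on the whole line is constant.\<close>
    have "0 \<le> k + 2 * u * inner (D \<eta>) \<xi>" for u
    proof -
      define v w where "v = f a (u *\<^sub>R \<xi>)" and "w = f b \<eta>"
      define z where "z = (\<lambda>i::nat. if i = 0 then - (v + w) else if i = 1 then u *\<^sub>R \<xi> else \<eta>)"
      have "(\<Sum>i<3. \<Sum>j<3. cinner (f (adj (X i) o\<^sub>L X j) (z j)) (z i)) \<in> \<real>\<^sub>\<ge>\<^sub>0"
        using pos unfolding positive_mat_iff by blast
      then have "0 \<le> Re (\<Sum>i<3. \<Sum>j<3. cinner (f (adj (X i) o\<^sub>L X j) (z j)) (z i))"
        by (simp add: complex_nonneg_Reals_iff)
      also have "(\<Sum>i<3. \<Sum>j<3. cinner (f (adj (X i) o\<^sub>L X j) (z j)) (z i)) =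
          cinner (v + w) (v + w) - cinner v (v + w) - cinner w (v + w)
          - cinner (v + w) v + cinner v v + cinner (f (adj a o\<^sub>L b) \<eta>) (u *\<^sub>R \<xi>)
          - cinner (v + w) w + cinner (u *\<^sub>R \<xi>) (f (adj a o\<^sub>L b) \<eta>) + cinner (f (adj b o\<^sub>L b) \<eta>) \<eta>"
        by (simp add: numeral_3_eq_3 z_def X_def adj1 id unital cp_adj a b eq ab
            cinner_adj_left cp_bops vna_compose[OF vna] vna_adj[OF vna] cinner.minus_left
            cinner.minus_right cinner.add_left cinner.add_right cinner.diff_left cinner.diff_right
            blinfun.minus_right blinfun.diff_right v_def[symmetric] w_def[symmetric])
      also have "Re \<dots> = k + 2 * u * inner (D \<eta>) \<xi>"
      proof -
        have "inner (D \<eta>) (u *\<^sub>R \<xi>) = inner (f (adj a o\<^sub>L b) \<eta>) (u *\<^sub>R \<xi>) - inner w v"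
          by (simp add: D_def blinfun.diff_left cinner.diff_left Re_cinner[symmetric]
              cinner_adj_left cp_bops a v_def w_def del: inner_scaleR_right)
        then show ?thesis
          by (simp add: Re_cinner k_def w_def[symmetric] power2_norm_eq_inner inner_add_left
              inner_add_right inner_commute algebra_simps)
      qed
      finally show ?thesis .
    qed
    note q = this
    show ?thesis
    proof (rule ccontr)
      assume "inner (D \<eta>) \<xi> \<noteq> 0"
      then show False using q[of "- (k + 1) / (2 * inner (D \<eta>) \<xi>)"] by (simp add: field_simps)
    qed
  qed
  have "D = 0"
  proof (rule blinfun_eqI)
    show "D \<eta> = blinfun_apply 0 \<eta>" for \<eta>
      using inner_zero[of \<eta> "D \<eta>"] by simp
  qed
  then show ?thesis by (simp add: D_def)
qed

text \<open>
  The left and the right module property come from the multiplicative domain of \<open>a\<^sup>*\<close> and of \<open>a\<close>,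
  the latter after taking adjoints.
\<close>

lemma cp_bimodule:
  assumes a: "a \<in> M" and fa: "f a = a" and l: "f (adj a o\<^sub>L a) = adj a o\<^sub>L a"
    and r: "f (a o\<^sub>L adj a) = a o\<^sub>L adj a" and b: "b \<in> M"
  shows "f (a o\<^sub>L b) = a o\<^sub>L f b" and "f (b o\<^sub>L a) = f b o\<^sub>L a"
proof -
  have aa: "adj (adj a) = a" "adj (adj b) = b"
    using a b vna_bops[OF vna] by (auto intro: adj_adj)
  have fa': "f (adj a) = adj a" using cp_adj[OF a] fa by simp
  show "f (a o\<^sub>L b) = a o\<^sub>L f b"
    using cp_multiplicative_domain[of "adj a" b] a b r fa' by (simp add: aa vna_adj[OF vna])
  have "f (adj a o\<^sub>L adj b) = adj a o\<^sub>L f (adj b)"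
    using cp_multiplicative_domain[of a "adj b"] a b l fa by (simp add: vna_adj[OF vna])
  then have "adj (f (adj a o\<^sub>L adj b)) = adj (adj a o\<^sub>L f (adj b))" by simp
  moreover have "adj (f (adj a o\<^sub>L adj b)) = f (b o\<^sub>L a)"
    using cp_adj[of "adj a o\<^sub>L adj b"] a b
    by (simp add: adj_compose vna_bops[OF vna] vna_adj[OF vna] vna_compose[OF vna] aa)
  moreover have "adj (adj a o\<^sub>L f (adj b)) = f b o\<^sub>L a"
    using cp_adj[of "adj b"] a b
    by (simp add: adj_compose vna_bops[OF vna] vna_adj[OF vna] cp_bops aa)
  ultimately show "f (b o\<^sub>L a) = f b o\<^sub>L a" by simp
qed

end

text \<open>
  The norm of an operator matrix is the best constant in the hypothesis of \<open>cp_matrix_bound\<close>, by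
  homogeneity.
\<close>

lemma cp_completely_contractive:
  assumes vna: "von_neumann_algebra M" and cp: "completely_positive M f"
    and unital: "f id_blinfun = id_blinfun"
  shows "completely_contractive M f"
  unfolding completely_contractive_def
proof (intro conjI allI impI)
  show "linear_selfmap M f" using cp by (simp add: completely_positive_def)
  fix n and A :: "nat \<Rightarrow> nat \<Rightarrow> 'a \<Rightarrow>\<^sub>L 'a"
  assume A: "\<forall>i<n. \<forall>j<n. A i j \<in> M"
  let ?N = "\<lambda>x. L2_set (\<lambda>i. norm (x i)) {..<n}"
  let ?B = "{x :: nat \<Rightarrow> 'a. (\<Sum>j<n. (norm (x j))\<^sup>2) \<le> 1}"
  have ball: "x \<in> ?B \<longleftrightarrow> ?N x \<le> 1" for x
    by (simp add: L2_set_def real_sqrt_le_1_iff)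
  have mat_norm: "mat_norm n G = (SUP x\<in>?B. ?N (mat_apply n G x))" for G :: "nat \<Rightarrow> nat \<Rightarrow> 'a \<Rightarrow>\<^sub>L 'a"
    by (simp add: mat_norm_def L2_set_def)
  have apply_scaleR: "mat_apply n G (\<lambda>i. r *\<^sub>R x i) = (\<lambda>i. r *\<^sub>R mat_apply n G x i)"
    for G :: "nat \<Rightarrow> nat \<Rightarrow> 'a \<Rightarrow>\<^sub>L 'a" and r x
    by (intro ext) (simp add: mat_apply_def blinfun.scaleR_right scaleR_sum_right)
  have N_scaleR: "?N (\<lambda>i. r *\<^sub>R x i) = \<bar>r\<bar> * ?N x" for r and x :: "nat \<Rightarrow> 'a"
    using L2_set_right_distrib[of "\<bar>r\<bar>" "\<lambda>i. norm (x i)"] by simp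
  have "?N (mat_apply n A x) \<le> (\<Sum>i<n. \<Sum>j<n. norm (A i j))" if "x \<in> ?B" for x
  proof -
    have x1: "norm (x j) \<le> 1" if "j < n" for j
      using member_le_L2_set[of "{..<n}" j "\<lambda>i. norm (x i)"] \<open>x \<in> ?B\<close>[unfolded ball] that by simp
    have "?N (mat_apply n A x) \<le> (\<Sum>i<n. norm (mat_apply n A x i))"
      by (rule L2_set_le_sum) simp
    also have "\<dots> \<le> (\<Sum>i<n. \<Sum>j<n. norm (A i j))"
      unfolding mat_apply_def
    proof (intro sum_mono order_trans[OF norm_sum])
      fix i j assume "j \<in> {..<n}"
      then show "norm (A i j (x j)) \<le> norm (A i j)"
        using order_trans[OF norm_blinfun mult_left_mono[OF x1[of j] norm_ge_zero[of "A i j"]]] by simp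
    qed
    finally show ?thesis .
  qed
  then have bdd: "bdd_above ((\<lambda>x. ?N (mat_apply n A x)) ` ?B)" by (rule bdd_aboveI2)
  have zero: "(\<lambda>_. 0) \<in> ?B" by simp
  have "0 \<le> ?N (mat_apply n A (\<lambda>_. 0))" by simp
  also have "\<dots> \<le> mat_norm n A" unfolding mat_norm by (rule cSUP_upper[OF zero bdd])
  finally have c: "0 \<le> mat_norm n A" .
  have bd: "?N (mat_apply n A y) \<le> mat_norm n A * ?N y" for y
  proof (cases "?N y = 0")
    case True
    then have "y j = 0" if "j < n" for j using that by (simp add: L2_set_eq_0_iff)
    then have "mat_apply n A y = (\<lambda>_. 0)" by (simp add: mat_apply_def fun_eq_iff)
    then show ?thesis using True by (simp add: L2_set_def)
  next
    case False
    then have pos: "?N y > 0" using L2_set_nonneg by (metis less_eq_real_def)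
    have "(\<lambda>i. (1 / ?N y) *\<^sub>R y i) \<in> ?B"
      unfolding ball N_scaleR using pos by simp
    then have "?N (mat_apply n A (\<lambda>i. (1 / ?N y) *\<^sub>R y i)) \<le> mat_norm n A"
      unfolding mat_norm by (rule cSUP_upper[OF _ bdd])
    then show ?thesis
      unfolding apply_scaleR N_scaleR using pos by (simp add: field_simps)
  qed
  \<comment> \<open>Extended by zero beyond the \<open>n \<times> n\<close> range, the matrix has all its entries in \<open>M\<close>.\<close>
  define A' where "A' = (\<lambda>i j. if i < n \<and> j < n then A i j else 0)"
  have A'M: "A' i j \<in> M" for i j using A vna_zero[OF vna] by (simp add: A'_def)
  have N_A': "?N (mat_apply n (\<lambda>i j. g (A' i j)) y) = ?N (mat_apply n (\<lambda>i j. g (A i j)) y)"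
    for g :: "('a \<Rightarrow>\<^sub>L 'a) \<Rightarrow> ('a \<Rightarrow>\<^sub>L 'a)" and y
    by (intro L2_set_cong refl arg_cong[of _ _ norm]) (simp add: mat_apply_def A'_def)
  have bd': "?N (mat_apply n A' y) \<le> mat_norm n A * ?N y" for y
    using bd[of y] unfolding N_A'[of "\<lambda>a. a" y] .
  show "mat_norm n (\<lambda>i j. f (A i j)) \<le> mat_norm n A"
    unfolding mat_norm[of "\<lambda>i j. f (A i j)"]
  proof (rule cSUP_least)
    show "?B \<noteq> {}" unfolding ex_in_conv[symmetric] using zero by (rule exI[of _ "\<lambda>_. 0"])
    fix x assume "x \<in> ?B"
    have "?N (mat_apply n (\<lambda>i j. f (A' i j)) x) \<le> mat_norm n A * ?N x"
      by (rule cp_matrix_bound[OF vna cp unital A'M c bd'])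
    also have "\<dots> \<le> mat_norm n A"
      using \<open>x \<in> ?B\<close> c unfolding ball by (metis L2_set_nonneg mult_left_le)
    finally show "?N (mat_apply n (\<lambda>i j. f (A i j)) x) \<le> mat_norm n A" unfolding N_A' .
  qed
qed

section \<open>Ergodic averages\<close>

text \<open>
  Tychonoff's theorem in the form of a refinement of the filter \<open>sequentially\<close>: the product of
  the discs of radii \<open>C i\<close> is compact, so the sequence \<open>K\<close> has a cluster point there.
\<close>

lemma pointwise_convergent_filter:
  fixes K :: "nat \<Rightarrow> 'i \<Rightarrow> complex"
  assumes bd: "\<And>n i. cmod (K n i) \<le> C i"
  shows "\<exists>F L. F \<noteq> bot \<and> F \<le> sequentially \<and> (\<forall>i. ((\<lambda>n. K n i) \<longlongrightarrow> L i) F)"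
proof -
  have "compactin euclidean (PiE UNIV (\<lambda>i::'i. cball (0::complex) (C i)))"
    unfolding euclidean_product_topology[symmetric] compactin_PiE by simp
  then have "compact (PiE UNIV (\<lambda>i::'i. cball (0::complex) (C i)))" by simp
  moreover have "eventually (\<lambda>x. x \<in> PiE UNIV (\<lambda>i. cball 0 (C i))) (filtermap K sequentially)"
    using bd by (simp add: eventually_filtermap PiE_UNIV_domain)
  moreover have "filtermap K sequentially \<noteq> bot" by (simp add: filtermap_bot_iff)
  ultimately obtain L where L: "inf (nhds L) (filtermap K sequentially) \<noteq> bot"
    unfolding compact_filter by blast
  define F where "F = inf sequentially (filtercomap K (nhds L))"
  have "F \<noteq> bot"
  proof
    assume "F = bot"
    then have "eventually (\<lambda>_. False) F" by simp
    then obtain P Q where "eventually P sequentially" and Q: "eventually Q (nhds L)"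
      and PQ: "\<And>n. P n \<Longrightarrow> \<not> Q (K n)"
      unfolding F_def eventually_inf eventually_filtercomap by blast
    then have "eventually (\<lambda>x. \<not> Q x) (filtermap K sequentially)"
      by (auto simp: eventually_filtermap elim: eventually_mono)
    with Q have "eventually (\<lambda>_. False) (inf (nhds L) (filtermap K sequentially))"
      unfolding eventually_inf by blast
    with L show False by (simp add: eventually_False)
  qed
  moreover have "filterlim K (nhds L) F"
    unfolding F_def by (rule filterlim_mono[OF filterlim_filtercomap order_refl inf_le2])
  then have "((\<lambda>n. K n i) \<longlongrightarrow> L i) F" for i
    using continuous_on_tendsto_compose[OF continuous_on_product_coordinates[of i], of K L F] by simp
  moreover have "F \<le> sequentially" unfolding F_def by simp
  ultimately show ?thesis by blast
qed

text \<open>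
  Shifting a window of length \<open>N\<close> by \<open>s\<close> replaces only \<open>s\<close> of its terms, whatever \<open>N\<close> is. This is why
  averages become invariant.
\<close>

lemma norm_sum_shift_le:
  fixes g :: "nat \<Rightarrow> 'b::real_normed_vector"
  assumes bd: "\<And>k. norm (g k) \<le> B"
  shows "norm ((\<Sum>k<N. g (k + s)) - (\<Sum>k<N. g k)) \<le> real s * (2 * B)"
proof (induction s)
  case (Suc s)
  have step: "(\<Sum>k<N. g (k + Suc s)) - (\<Sum>k<N. g (k + s)) = g (N + s) - g s"
    using sum_lessThan_telescope[of "\<lambda>k. g (k + s)" N] by (simp add: sum_subtractf)
  have "norm ((\<Sum>k<N. g (k + Suc s)) - (\<Sum>k<N. g k)) \<le>
      norm ((\<Sum>k<N. g (k + Suc s)) - (\<Sum>k<N. g (k + s))) + norm ((\<Sum>k<N. g (k + s)) - (\<Sum>k<N. g k))"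
    using norm_triangle_ineq[of "(\<Sum>k<N. g (k + Suc s)) - (\<Sum>k<N. g (k + s))"
        "(\<Sum>k<N. g (k + s)) - (\<Sum>k<N. g k)"] by simp
  also have "norm ((\<Sum>k<N. g (k + Suc s)) - (\<Sum>k<N. g (k + s))) \<le> 2 * B"
    unfolding step using norm_triangle_ineq4[of "g (N + s)" "g s"] bd[of "N + s"] bd[of s] by linarith
  finally show ?case using Suc.IH by (simp add: algebra_simps)
qed simp

context
  fixes M :: "('h::chilbert_space \<Rightarrow>\<^sub>L 'h) set"
    and \<Phi> :: "real \<Rightarrow> ('h \<Rightarrow>\<^sub>L 'h) \<Rightarrow> ('h \<Rightarrow>\<^sub>L 'h)"
  assumes vna: "von_neumann_algebra M" and sg: "wstar_semigroup M \<Phi>"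
    and cp: "\<And>t. t \<ge> 0 \<Longrightarrow> completely_positive M (\<Phi> t)"
    and unital: "\<And>t. t \<ge> 0 \<Longrightarrow> \<Phi> t id_blinfun = id_blinfun"
    and wcont: "\<And>t. t \<ge> 0 \<Longrightarrow> wstar_continuous M (\<Phi> t)"
begin

lemma semigroup_add: "s \<ge> 0 \<Longrightarrow> t \<ge> 0 \<Longrightarrow> a \<in> M \<Longrightarrow> \<Phi> s (\<Phi> t a) = \<Phi> (s + t) a"
  using sg by (auto simp: wstar_semigroup_def)

text \<open>
  The mesh \<open>2\<^sup>-\<^sup>n\<close> makes every dyadic time an integral number of steps for large \<open>n\<close>, while the
  averaged time span \<open>2\<^sup>n\<close> tends to infinity.
\<close>

definition average :: "nat \<Rightarrow> ('h \<Rightarrow>\<^sub>L 'h) \<Rightarrow> ('h \<Rightarrow>\<^sub>L 'h)" where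
  "average n a = (1 / 4 ^ n) *\<^sub>R (\<Sum>k<4 ^ n. \<Phi> (real k / 2 ^ n) a)"

lemma average_closed: "a \<in> M \<Longrightarrow> average n a \<in> M"
  unfolding average_def
  by (intro vna_scaleR[OF vna] vna_sum[OF vna] cp_closed[OF vna cp unital]) auto

lemma average_fixed:
  assumes "\<And>t. t \<ge> 0 \<Longrightarrow> \<Phi> t a = a"
  shows "average n a = a"
  using assms by (simp add: average_def sum_constant_scaleR)

lemma average_add: "a \<in> M \<Longrightarrow> b \<in> M \<Longrightarrow> average n (a + b) = average n a + average n b"
  by (simp add: average_def cp_add[OF vna cp unital] sum.distrib scaleR_add_right)

lemma scale_op_sum: "scale_op c (sum g I) = (\<Sum>i\<in>I. scale_op c (g i))"
  for g :: "'i \<Rightarrow> ('h \<Rightarrow>\<^sub>L 'h)"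
proof -
  have zero: "scale_op c (0 :: 'h \<Rightarrow>\<^sub>L 'h) = 0"
    by (rule blinfun_eqI) (simp add: linear_0[OF bounded_linear.linear[OF bounded_linear_scaleC]])
  have "scale_op c (u + v) = scale_op c u + scale_op c v" for u v :: "'h \<Rightarrow>\<^sub>L 'h"
    by (rule blinfun_eqI) (simp add: blinfun.add_left scaleC_add_right)
  then show ?thesis by (induction I rule: infinite_finite_induct) (simp_all add: zero)
qed

lemma average_scale: "a \<in> M \<Longrightarrow> average n (scale_op c a) = scale_op c (average n a)"
proof -
  assume "a \<in> M"
  then have "average n (scale_op c a) = (1 / 4 ^ n) *\<^sub>R scale_op c (\<Sum>k<4 ^ n. \<Phi> (real k / 2 ^ n) a)"
    by (simp add: average_def cp_scale[OF vna cp unital] scale_op_sum)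
  also have "\<dots> = scale_op c (average n a)"
    unfolding average_def
    by (rule blinfun_eqI)
      (simp add: blinfun.scaleR_left scaleC_of_real[symmetric] scaleC_scaleC mult.commute)
  finally show ?thesis .
qed

lemma norm_average_le:
  assumes a: "a \<in> M"
  shows "norm (average n a) \<le> norm a"
proof -
  have "norm (\<Sum>k<4 ^ n. \<Phi> (real k / 2 ^ n) a) \<le> (\<Sum>k<4 ^ n::nat. norm a)"
    by (intro order_trans[OF norm_sum] sum_mono cp_contractive[OF vna cp unital a]) auto
  then show ?thesis by (simp add: average_def field_simps)
qed

lemma nonneg_Reals_sum: "(\<And>i. i \<in> I \<Longrightarrow> z i \<in> \<real>\<^sub>\<ge>\<^sub>0) \<Longrightarrow> sum z I \<in> \<real>\<^sub>\<ge>\<^sub>0"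
  for z :: "'i \<Rightarrow> complex"
  by (induction I rule: infinite_finite_induct) (auto intro: nonneg_Reals_add_I)

lemma average_positive_mat:
  assumes X: "\<And>i j. i < m \<Longrightarrow> j < m \<Longrightarrow> X i j \<in> M" and pos: "positive_mat m X"
  shows "positive_mat m (\<lambda>i j. average n (X i j))"
  unfolding positive_mat_iff
proof
  fix x :: "nat \<Rightarrow> 'h"
  let ?q = "\<lambda>k. \<Sum>i<m. \<Sum>j<m. cinner (\<Phi> (real k / 2 ^ n) (X i j) (x j)) (x i)"
  have q: "?q k \<in> \<real>\<^sub>\<ge>\<^sub>0" for k
    using cp_positive[OF vna cp unital, of "real k / 2 ^ n" m X] X pos
    by (simp add: positive_mat_iff)
  have "(\<Sum>i<m. \<Sum>j<m. cinner (average n (X i j) (x j)) (x i)) =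
      (1 / 4 ^ n) *\<^sub>R (\<Sum>i<m. \<Sum>j<m. \<Sum>k<4 ^ n. cinner (\<Phi> (real k / 2 ^ n) (X i j) (x j)) (x i))"
    by (simp add: average_def blinfun.scaleR_left blinfun.sum_left cinner.scaleR_left cinner.sum_left
        scaleR_sum_right)
  also have "(\<Sum>i<m. \<Sum>j<m. \<Sum>k<4 ^ n. cinner (\<Phi> (real k / 2 ^ n) (X i j) (x j)) (x i)) = (\<Sum>k<4 ^ n. ?q k)"
    by (subst sum.swap[of _ "{..<4 ^ n}"]) (intro sum.cong refl sum.swap)
  also have "(1 / 4 ^ n) *\<^sub>R (\<Sum>k<4 ^ n. ?q k) \<in> \<real>\<^sub>\<ge>\<^sub>0"
    unfolding scaleR_conv_of_real by (intro nonneg_Reals_mult_I nonneg_Reals_sum q) simp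
  finally show "(\<Sum>i<m. \<Sum>j<m. cinner (average n (X i j) (x j)) (x i)) \<in> \<real>\<^sub>\<ge>\<^sub>0" .
qed

text \<open>
  The time \<open>p / 2\<^sup>m\<close> is \<open>s = p 2\<^sup>n\<^sup>-\<^sup>m\<close> steps of the mesh, and \<open>s\<close> is at most \<open>p 2\<^sup>n\<close> out of \<open>4\<^sup>n\<close> terms.
\<close>

lemma average_almost_invariant:
  assumes a: "a \<in> M" and n: "m \<le> n"
  shows "norm (\<Phi> (real p / 2 ^ m) (average n a) - average n a) \<le> real p * (2 * norm a) / 2 ^ n"
proof -
  define g where "g = (\<lambda>k::nat. \<Phi> (real k / 2 ^ n) a)"
  define s where "s = p * 2 ^ (n - m)"
  have "(2::real) ^ (n - m) = 2 ^ n / 2 ^ m" using n by (simp add: power_diff)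
  then have s: "real s = real p / 2 ^ m * 2 ^ n" by (simp add: s_def)
  have gM: "g k \<in> M" for k unfolding g_def by (intro cp_closed[OF vna cp unital a]) auto
  have shift: "\<Phi> (real p / 2 ^ m) (g k) = g (k + s)" for k
  proof -
    have "real p / 2 ^ m + real k / 2 ^ n = real (k + s) / 2 ^ n"
      by (simp add: s add_divide_distrib)
    then show ?thesis unfolding g_def using a by (simp add: semigroup_add)
  qed
  have "\<Phi> (real p / 2 ^ m) (average n a) = (1 / 4 ^ n) *\<^sub>R (\<Sum>k<4 ^ n. g (k + s))"
    unfolding average_def g_def[symmetric]
    by (simp add: cp_scaleR[OF vna cp unital] cp_sum[OF vna cp unital] vna_sum[OF vna] gM shift)
  then have "\<Phi> (real p / 2 ^ m) (average n a) - average n a =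
      (1 / 4 ^ n) *\<^sub>R ((\<Sum>k<4 ^ n. g (k + s)) - (\<Sum>k<4 ^ n. g k))"
    by (simp add: average_def g_def scaleR_diff_right)
  then have "norm (\<Phi> (real p / 2 ^ m) (average n a) - average n a) =
      norm ((\<Sum>k<4 ^ n. g (k + s)) - (\<Sum>k<4 ^ n. g k)) / 4 ^ n" by simp
  also have "norm ((\<Sum>k<4 ^ n. g (k + s)) - (\<Sum>k<4 ^ n. g k)) \<le> real s * (2 * norm a)"
    unfolding g_def by (intro norm_sum_shift_le cp_contractive[OF vna cp unital a]) auto
  also have "real s * (2 * norm a) / 4 ^ n = real p / 2 ^ m * (2 * norm a) / 2 ^ n"
  proof -
    have "(4::real) ^ n = 2 ^ n * 2 ^ n" by (simp flip: power_mult_distrib)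
    then show ?thesis unfolding s by simp
  qed
  also have "\<dots> \<le> real p * (2 * norm a) / 2 ^ n"
  proof -
    have "real p / 2 ^ m \<le> real p" by (simp add: divide_le_eq mult_le_cancel_left1)
    then show ?thesis by (intro divide_right_mono mult_right_mono) auto
  qed
  finally show ?thesis by (simp add: divide_right_mono)
qed

lemma dyadic_approximation:
  fixes t :: real
  assumes "t \<ge> 0"
  shows "(\<lambda>m. real (nat \<lfloor>t * 2 ^ m\<rfloor>) / 2 ^ m) \<longlonglongrightarrow> t"
proof (rule tendsto_sandwich[of "\<lambda>m. t - (1 / 2) ^ m" _ _ "\<lambda>m. t"])
  show "(\<lambda>m. t - (1 / 2) ^ m) \<longlonglongrightarrow> t"
    using tendsto_diff[OF tendsto_const LIMSEQ_power_zero[of "1 / 2 :: real"], of t] by simp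
  have floor: "real (nat \<lfloor>t * 2 ^ m\<rfloor>) \<le> t * 2 ^ m" "t * 2 ^ m - 1 \<le> real (nat \<lfloor>t * 2 ^ m\<rfloor>)" for m
  proof -
    have "0 \<le> \<lfloor>t * 2 ^ m\<rfloor>" using assms by simp
    then have "real (nat \<lfloor>t * 2 ^ m\<rfloor>) = of_int \<lfloor>t * 2 ^ m\<rfloor>" by simp
    then show "real (nat \<lfloor>t * 2 ^ m\<rfloor>) \<le> t * 2 ^ m" "t * 2 ^ m - 1 \<le> real (nat \<lfloor>t * 2 ^ m\<rfloor>)"
      by linarith+
  qed
  have "real (nat \<lfloor>t * 2 ^ m\<rfloor>) / 2 ^ m \<le> t" for m
    using floor(1)[of m] by (simp add: divide_le_eq)
  then show "\<forall>\<^sub>F m in sequentially. real (nat \<lfloor>t * 2 ^ m\<rfloor>) / 2 ^ m \<le> t"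
    by (intro always_eventually allI)
  have "t - (1 / 2) ^ m \<le> real (nat \<lfloor>t * 2 ^ m\<rfloor>) / 2 ^ m" for m
  proof -
    have "t - (1 / 2) ^ m = (t * 2 ^ m - 1) / 2 ^ m" by (simp add: diff_divide_distrib power_divide)
    also have "\<dots> \<le> real (nat \<lfloor>t * 2 ^ m\<rfloor>) / 2 ^ m" by (intro divide_right_mono floor) simp
    finally show ?thesis .
  qed
  then show "\<forall>\<^sub>F m in sequentially. t - (1 / 2) ^ m \<le> real (nat \<lfloor>t * 2 ^ m\<rfloor>) / 2 ^ m"
    by (intro always_eventually allI)
qed simp

lemma fixed_by_dyadic_times:
  assumes b: "b \<in> M" and dy: "\<And>p m. \<Phi> (real p / 2 ^ m) b = b" and t: "t \<ge> 0"
  shows "\<Phi> t b = b"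
proof (rule blinfun_cinner_ext)
  fix x y
  have "continuous_map (top_of_set {0..}) wstar (\<lambda>t. \<Phi> t b)"
    using sg b by (auto simp: wstar_semigroup_def intro: continuous_map_into_fulltopology)
  from continuous_map_compose[OF this continuous_map_wstar_coefficient[of x y]]
  have "continuous_on {0..} (\<lambda>t. cinner (\<Phi> t b x) y)" by (simp add: o_def)
  then have "(\<lambda>m. cinner (\<Phi> (real (nat \<lfloor>t * 2 ^ m\<rfloor>) / 2 ^ m) b x) y) \<longlonglongrightarrow> cinner (\<Phi> t b x) y"
    by (rule continuous_on_tendsto_compose[OF _ dyadic_approximation[OF t]]) (use t in auto)
  then have "(\<lambda>m::nat. cinner (b x) y) \<longlonglongrightarrow> cinner (\<Phi> t b x) y" unfolding dy .
  then show "cinner (\<Phi> t b x) y = cinner (b x) y"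
    by (metis LIMSEQ_unique tendsto_const)
qed

lemma ergodic_projection:
  "\<exists>\<Psi>. completely_positive M \<Psi> \<and> \<Psi> id_blinfun = id_blinfun \<and> idempotent_on M \<Psi> \<and>
     fixed_points M \<Phi> = \<Psi> ` M"
proof -
  \<comment> \<open>The averages are controlled on \<open>M\<close> only; the default \<open>0\<close> keeps the coefficients bounded elsewhere.\<close>
  define K where "K = (\<lambda>n (a, x, y). if a \<in> M then cinner (average n a x) y else 0)"
  have coef_bd: "cmod (cinner (average n a x) y) \<le> norm a * norm x * norm y" if "a \<in> M" for n a x y
  proof -
    have "norm (average n a x) \<le> norm a * norm x"
      using norm_blinfun[of "average n a" x] mult_right_mono[OF norm_average_le[OF that] norm_ge_zero]
      by (rule order_trans)
    from mult_right_mono[OF this norm_ge_zero[of y]] norm_cinner_le[of "average n a x" y]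
    show ?thesis by linarith
  qed
  have "cmod (K n i) \<le> (\<lambda>(a, x, y). norm a * norm x * norm y) i" for n i
    using coef_bd by (auto simp: K_def split: prod.split)
  then obtain F L where F: "F \<noteq> bot" "F \<le> sequentially" and KL: "\<And>i. ((\<lambda>n. K n i) \<longlongrightarrow> L i) F"
    using pointwise_convergent_filter[of K "\<lambda>(a, x, y). norm a * norm x * norm y"] by blast
  have lim: "((\<lambda>n. cinner (average n a x) y) \<longlongrightarrow> L (a, x, y)) F" if "a \<in> M" for a x y
    using KL[of "(a, x, y)"] that by (simp add: K_def)
  note uniq = tendsto_unique[OF F(1)]
  have "\<exists>T\<in>bops. \<forall>x y. cinner (blinfun_apply T x) y = L (a, x, y)" if a: "a \<in> M" for a
  proof (rule bounded_form_operator)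
    note ab = bops_scaleC[OF vna_bops[OF vna average_closed[OF a]]]
    show "L (a, x + x', y) = L (a, x, y) + L (a, x', y)" for x x' y
      by (rule uniq[OF lim[OF a]])
        (use tendsto_add[OF lim[OF a] lim[OF a]] in \<open>simp add: blinfun.add_right cinner.add_left\<close>)
    show "L (a, x, y + y') = L (a, x, y) + L (a, x, y')" for x y y'
      by (rule uniq[OF lim[OF a]])
        (use tendsto_add[OF lim[OF a] lim[OF a]] in \<open>simp add: cinner.add_right\<close>)
    show "L (a, c *\<^sub>C x, y) = c * L (a, x, y)" for c x y
      by (rule uniq[OF lim[OF a]])
        (use tendsto_mult_left[OF lim[OF a]] in \<open>simp add: ab cinner_scaleC_left\<close>)
    show "L (a, x, c *\<^sub>C y) = cnj c * L (a, x, y)" for c x y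
      by (rule uniq[OF lim[OF a]])
        (use tendsto_mult_left[OF lim[OF a]] in \<open>simp add: cinner_scaleC_right\<close>)
    show "cmod (L (a, x, y)) \<le> norm a * norm x * norm y" for x y
      by (rule tendsto_upperbound[OF tendsto_norm[OF lim[OF a]] always_eventually F(1)])
        (use coef_bd[OF a] in blast)
  qed
  then obtain \<Psi> where \<Psi>: "\<And>a. a \<in> M \<Longrightarrow> \<Psi> a \<in> bops"
    "\<And>a x y. a \<in> M \<Longrightarrow> cinner (\<Psi> a x) y = L (a, x, y)" by metis
  have lim\<Psi>: "((\<lambda>n. cinner (average n a x) y) \<longlongrightarrow> cinner (\<Psi> a x) y) F" if "a \<in> M" for a x y
    using lim \<Psi>(2) that by simp
  have wlim: "limitin wstar (\<lambda>n. average n a) (\<Psi> a) F" if a: "a \<in> M" for a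
    using F(1) \<Psi>(1)[OF a] vna_bops[OF vna average_closed[OF a]] norm_average_le[OF a] lim\<Psi>[OF a]
    by (rule limitin_wstar_bounded)
  have \<Psi>M: "\<Psi> a \<in> M" if a: "a \<in> M" for a
    using limitin_closedin[OF wlim[OF a] vna_closed[OF vna]] average_closed[OF a] F(1) by simp
  have \<Psi>_fixed: "\<Psi> a = a" if "a \<in> fixed_points M \<Phi>" for a
  proof (rule blinfun_cinner_ext)
    show "cinner (\<Psi> a x) y = cinner (a x) y" for x y
      using uniq[OF lim\<Psi>[of a x y], of "cinner (a x) y"] that average_fixed[of a]
      by (simp add: fixed_points_def)
  qed
  \<comment> \<open>Ultraweak continuity of the maps of the semigroup lets them pass to the limit.\<close>
  have dyadic: "\<Phi> (real p / 2 ^ m) (\<Psi> a) = \<Psi> a" if a: "a \<in> M" for a p m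
  proof (rule blinfun_cinner_ext)
    fix x y
    let ?q = "real p / 2 ^ m"
    have "continuous_map (subtopology wstar M) wstar (\<Phi> ?q)"
      using wcont[of ?q] by (auto simp: wstar_continuous_def intro: continuous_map_into_fulltopology)
    then have "limitin wstar (\<Phi> ?q \<circ> (\<lambda>n. average n a)) (\<Phi> ?q (\<Psi> a)) F"
      by (rule continuous_map_limit) (simp add: limitin_subtopology \<Psi>M average_closed wlim a)
    from continuous_map_limit[OF continuous_map_wstar_coefficient[of x y] this]
    have l1: "((\<lambda>n. cinner (\<Phi> ?q (average n a) x) y) \<longlongrightarrow> cinner (\<Phi> ?q (\<Psi> a) x) y) F"
      by (simp add: o_def)
    have "(\<lambda>n. real p * (2 * norm a) / 2 ^ n) \<longlonglongrightarrow> 0"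
      by (intro LIMSEQ_divide_realpow_zero) simp
    then have "(\<lambda>n. \<Phi> ?q (average n a) - average n a) \<longlonglongrightarrow> 0"
      by (rule Lim_null_comparison[rotated])
        (use average_almost_invariant[OF a] in \<open>auto simp: eventually_sequentially\<close>)
    then have "((\<lambda>n. \<Phi> ?q (average n a) - average n a) \<longlongrightarrow> 0) F"
      using F(2) by (rule tendsto_mono[rotated])
    then have "((\<lambda>n. cinner ((\<Phi> ?q (average n a) - average n a) x) y) \<longlongrightarrow> cinner (blinfun_apply 0 x) y) F"
      by (intro cinner.tendsto blinfun.tendsto tendsto_const)
    with lim\<Psi>[OF a, of x y]
    have "((\<lambda>n. cinner (average n a x) y + cinner ((\<Phi> ?q (average n a) - average n a) x) y)
        \<longlongrightarrow> cinner (\<Psi> a x) y + cinner (blinfun_apply 0 x) y) F"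
      by (rule tendsto_add)
    then have "((\<lambda>n. cinner (\<Phi> ?q (average n a) x) y) \<longlongrightarrow> cinner (\<Psi> a x) y) F"
      by (simp add: blinfun.diff_left cinner.diff_left cinner.zero_left)
    with l1 show "cinner (\<Phi> ?q (\<Psi> a) x) y = cinner (\<Psi> a x) y" by (rule uniq)
  qed
  have \<Psi>_range: "\<Psi> a \<in> fixed_points M \<Phi>" if a: "a \<in> M" for a
    unfolding fixed_points_def using \<Psi>M[OF a] fixed_by_dyadic_times[OF \<Psi>M[OF a] dyadic[OF a]] by blast
  have "linear_selfmap M \<Psi>"
    unfolding linear_selfmap_def
  proof (intro conjI ballI allI)
    show "\<Psi> ` M \<subseteq> M" using \<Psi>M by blast
    show "\<Psi> (a + b) = \<Psi> a + \<Psi> b" if a: "a \<in> M" and b: "b \<in> M" for a b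
    proof (rule blinfun_cinner_ext)
      show "cinner (\<Psi> (a + b) x) y = cinner ((\<Psi> a + \<Psi> b) x) y" for x y
        using tendsto_add[OF lim\<Psi>[OF a, of x y] lim\<Psi>[OF b, of x y]]
        by (intro uniq[OF lim\<Psi>[OF vna_add[OF vna a b]]])
          (simp add: average_add[OF a b] blinfun.add_left cinner.add_left)
    qed
    show "\<Psi> (scale_op c a) = scale_op c (\<Psi> a)" if a: "a \<in> M" for c a
    proof (rule blinfun_cinner_ext)
      show "cinner (\<Psi> (scale_op c a) x) y = cinner (scale_op c (\<Psi> a) x) y" for x y
        using tendsto_mult_left[OF lim\<Psi>[OF a, of x y], of c]
        by (intro uniq[OF lim\<Psi>[OF vna_scale[OF vna a]]])
          (simp add: average_scale[OF a] cinner_scaleC_left)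
    qed
  qed
  moreover have "positive_mat m (\<lambda>i j. \<Psi> (X i j))"
    if X: "\<forall>i<m. \<forall>j<m. X i j \<in> M" and pos: "positive_mat m X" for m X
    unfolding positive_mat_iff
  proof
    fix x :: "nat \<Rightarrow> 'h"
    have "((\<lambda>n. \<Sum>i<m. \<Sum>j<m. cinner (average n (X i j) (x j)) (x i)) \<longlongrightarrow>
        (\<Sum>i<m. \<Sum>j<m. cinner (\<Psi> (X i j) (x j)) (x i))) F"
      using X by (intro tendsto_sum lim\<Psi>) auto
    moreover have "(\<Sum>i<m. \<Sum>j<m. cinner (average n (X i j) (x j)) (x i)) \<in> \<real>\<^sub>\<ge>\<^sub>0" for n
      using average_positive_mat[of m X n] X pos by (simp add: positive_mat_iff)
    ultimately show "(\<Sum>i<m. \<Sum>j<m. cinner (\<Psi> (X i j) (x j)) (x i)) \<in> \<real>\<^sub>\<ge>\<^sub>0"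
      by (intro Lim_in_closed_set[OF closed_nonneg_Reals_complex always_eventually F(1)]) auto
  qed
  ultimately have "completely_positive M \<Psi>" by (auto simp: completely_positive_def)
  moreover have "\<Psi> id_blinfun = id_blinfun"
    by (rule \<Psi>_fixed) (simp add: fixed_points_def vna_id[OF vna] unital)
  moreover have "idempotent_on M \<Psi>"
    by (auto simp: idempotent_on_def \<Psi>_fixed \<Psi>_range)
  moreover have "fixed_points M \<Phi> = \<Psi> ` M"
  proof (intro equalityI subsetI)
    show "a \<in> \<Psi> ` M" if "a \<in> fixed_points M \<Phi>" for a
      using image_eqI[of a \<Psi> a M] \<Psi>_fixed[OF that] that by (simp add: fixed_points_def)
  qed (use \<Psi>_range in blast)
  ultimately show ?thesis by blast
qed

section \<open>The algebraic structure of the fixed points\<close>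

text \<open>
  Each set \<open>\<Phi>\<^sub>t a = a\<close> is ultraweakly closed as the equalizer of two continuous maps into a
  Hausdorff space, and \<open>\<Phi>\<^sub>t\<close> commutes with the linear operations and with adjoints.
\<close>

lemma fixed_points_von_neumann_algebra:
  assumes "mult_stable (fixed_points M \<Phi>)"
  shows "von_neumann_algebra (fixed_points M \<Phi>)"
proof -
  let ?E = "\<lambda>t. {a \<in> topspace (subtopology wstar M). \<Phi> t a = a}"
  have "closedin wstar (?E t)" if "t \<ge> 0" for t
  proof (rule closedin_trans_full[OF _ vna_closed[OF vna]])
    have "continuous_map (subtopology wstar M) wstar (\<Phi> t)"
      using wcont[OF that] by (auto simp: wstar_continuous_def intro: continuous_map_into_fulltopology)
    then show "closedin (subtopology wstar M) (?E t)"
      by (intro closedin_continuous_maps_eq[OF Hausdorff_space_wstar])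
        (simp_all add: continuous_map_from_subtopology)
  qed
  then have "closedin wstar (\<Inter>t\<in>{0..}. ?E t)" by (intro closedin_Inter) auto
  moreover have "(\<Inter>t\<in>{0..}. ?E t) = fixed_points M \<Phi>"
    using vna_bops[OF vna] by (auto simp: fixed_points_def topspace_wstar)
  ultimately show ?thesis
    using assms unfolding von_neumann_algebra_def
    by (auto simp: fixed_points_def vna_bops[OF vna] vna_id[OF vna] vna_add[OF vna]
        vna_scale[OF vna] vna_adj[OF vna] unital cp_add[OF vna cp unital]
        cp_scale[OF vna cp unital] cp_adj[OF vna cp unital])
qed

text \<open>
  Taking \<open>b\<close> to be the identity shows that the bimodule domain always consists of fixed points; only
  the other inclusion needs the products \<open>a\<^sup>* a\<close> and \<open>a a\<^sup>*\<close> to be fixed.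
\<close>

lemma fixed_points_eq_bimodule_domain_iff:
  "mult_stable (fixed_points M \<Phi>) \<longleftrightarrow> fixed_points M \<Phi> = bimodule_domain M \<Phi>"
proof
  assume mult: "mult_stable (fixed_points M \<Phi>)"
  have id: "a o\<^sub>L id_blinfun = a" for a :: "'h \<Rightarrow>\<^sub>L 'h" by (rule blinfun_eqI) simp
  show "fixed_points M \<Phi> = bimodule_domain M \<Phi>"
  proof (intro equalityI subsetI)
    fix a assume a: "a \<in> fixed_points M \<Phi>"
    then have a': "adj a \<in> fixed_points M \<Phi>"
      by (simp add: fixed_points_def vna_adj[OF vna] cp_adj[OF vna cp unital])
    have "adj a o\<^sub>L a \<in> fixed_points M \<Phi>" "a o\<^sub>L adj a \<in> fixed_points M \<Phi>"
      using mult a a' by (auto simp: mult_stable_def)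
    with a show "a \<in> bimodule_domain M \<Phi>"
      by (auto simp: fixed_points_def bimodule_domain_def intro!: cp_bimodule[OF vna cp unital])
  next
    fix a assume "a \<in> bimodule_domain M \<Phi>"
    then have "a \<in> M" "\<And>t. t \<ge> 0 \<Longrightarrow> \<Phi> t (a o\<^sub>L id_blinfun) = a o\<^sub>L \<Phi> t id_blinfun"
      using vna_id[OF vna] unfolding bimodule_domain_def by blast+
    then show "a \<in> fixed_points M \<Phi>" by (simp add: fixed_points_def id unital)
  qed
next
  assume eq: "fixed_points M \<Phi> = bimodule_domain M \<Phi>"
  show "mult_stable (fixed_points M \<Phi>)"
    unfolding mult_stable_def
  proof (intro ballI)
    fix a b assume a: "a \<in> fixed_points M \<Phi>" and b: "b \<in> fixed_points M \<Phi>"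
    then have "a \<in> M" "b \<in> M" "\<And>t. t \<ge> 0 \<Longrightarrow> \<Phi> t b = b" by (auto simp: fixed_points_def)
    moreover have "\<And>t. t \<ge> 0 \<Longrightarrow> \<Phi> t (a o\<^sub>L b) = a o\<^sub>L \<Phi> t b"
      using a[unfolded eq] \<open>b \<in> M\<close> unfolding bimodule_domain_def by blast
    ultimately show "a o\<^sub>L b \<in> fixed_points M \<Phi>"
      by (simp add: fixed_points_def vna_compose[OF vna])
  qed
qed

end

text \<open>
  The range of an idempotent is its set of fixed points, so \<open>cp_bimodule\<close> applies to \<open>\<Psi>\<close> itself.
\<close>

lemma mult_stable_range_iff_conditional_expectation:
  assumes vna: "von_neumann_algebra M" and cp: "completely_positive M \<Psi>"
    and unital: "\<Psi> id_blinfun = id_blinfun" and idem: "idempotent_on M \<Psi>"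
  shows "mult_stable (\<Psi> ` M) \<longleftrightarrow> conditional_expectation M \<Psi>"
proof
  have fix_iff: "r \<in> \<Psi> ` M \<longleftrightarrow> r \<in> M \<and> \<Psi> r = r" for r
    using idem cp_closed[OF vna cp unital] by (force simp: idempotent_on_def)
  {
    assume mult: "mult_stable (\<Psi> ` M)"
    have "positive_op (\<Psi> a)" if a: "a \<in> M" and pos: "positive_op a" for a
      unfolding positive_op_def
    proof
      fix x
      have "positive_mat 1 (\<lambda>_ _. \<Psi> a)"
        using a pos by (intro cp_positive[OF vna cp unital])
          (auto simp: positive_mat_iff positive_op_def)
      then show "cinner (\<Psi> a x) x \<in> \<real>\<^sub>\<ge>\<^sub>0"
        unfolding positive_mat_iff by (elim allE[of _ "\<lambda>_. x"]) simp
    qed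
    then have "positive_map M \<Psi>"
      using cp by (simp add: positive_map_def completely_positive_def)
    moreover have "\<Psi> (a o\<^sub>L r) = \<Psi> a o\<^sub>L r \<and> \<Psi> (r o\<^sub>L a) = r o\<^sub>L \<Psi> a" if a: "a \<in> M" and r: "r \<in> \<Psi> ` M" for a r
    proof -
      have r': "adj r \<in> \<Psi> ` M"
        using r unfolding fix_iff by (simp add: vna_adj[OF vna] cp_adj[OF vna cp unital])
      have "adj r o\<^sub>L r \<in> \<Psi> ` M" "r o\<^sub>L adj r \<in> \<Psi> ` M"
        using mult r r' by (auto simp: mult_stable_def)
      with r a show ?thesis
        unfolding fix_iff by (auto intro!: cp_bimodule[OF vna cp unital])
    qed
    ultimately show "conditional_expectation M \<Psi>"
      using idem by (simp add: conditional_expectation_def)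
  next
    assume ce: "conditional_expectation M \<Psi>"
    show "mult_stable (\<Psi> ` M)"
      unfolding mult_stable_def
    proof (intro ballI)
      fix a b assume a: "a \<in> \<Psi> ` M" and b: "b \<in> \<Psi> ` M"
      then have "a \<in> M" by (simp add: fix_iff)
      then have "\<Psi> (a o\<^sub>L b) = \<Psi> a o\<^sub>L b"
        using ce b unfolding conditional_expectation_def by blast
      then show "a o\<^sub>L b \<in> \<Psi> ` M"
        using a b unfolding fix_iff by (simp add: vna_compose[OF vna])
    qed
  }
qed

theorem theorem2p6:
  fixes M :: "('h::chilbert_space \<Rightarrow>\<^sub>L 'h) set"
    and \<Phi> :: "real \<Rightarrow> ('h \<Rightarrow>\<^sub>L 'h) \<Rightarrow> ('h \<Rightarrow>\<^sub>L 'h)"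
  assumes "von_neumann_algebra M"
    and "wstar_semigroup M \<Phi>"
    and "\<And>t. t \<ge> 0 \<Longrightarrow> completely_positive M (\<Phi> t)"
    and "\<And>t. t \<ge> 0 \<Longrightarrow> \<Phi> t id_blinfun = id_blinfun"
    and "\<And>t. t \<ge> 0 \<Longrightarrow> wstar_continuous M (\<Phi> t)"
  shows "(\<exists>\<Psi>. completely_positive M \<Psi> \<and> \<Psi> id_blinfun = id_blinfun \<and> idempotent_on M \<Psi> \<and>
              fixed_points M \<Phi> = \<Psi> ` M)
    \<and> (\<forall>\<Psi>. completely_positive M \<Psi> \<and> \<Psi> id_blinfun = id_blinfun \<and> idempotent_on M \<Psi> \<and>
              fixed_points M \<Phi> = \<Psi> ` M \<longrightarrow>
          (mult_stable (fixed_points M \<Phi>) \<longleftrightarrow> von_neumann_algebra (fixed_points M \<Phi>))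
        \<and> (mult_stable (fixed_points M \<Phi>) \<longleftrightarrow> fixed_points M \<Phi> = bimodule_domain M \<Phi>)
        \<and> (mult_stable (fixed_points M \<Phi>) \<longleftrightarrow> conditional_expectation M \<Psi>))
    \<and> (M = bops \<and> mult_stable (fixed_points M \<Phi>) \<longrightarrow>
          von_neumann_algebra (fixed_points M \<Phi>) \<and> injective_space (fixed_points M \<Phi>))"
proof (intro conjI allI impI)
  show "\<exists>\<Psi>. completely_positive M \<Psi> \<and> \<Psi> id_blinfun = id_blinfun \<and> idempotent_on M \<Psi> \<and>
      fixed_points M \<Phi> = \<Psi> ` M"
    using assms by (rule ergodic_projection)
next
  show "mult_stable (fixed_points M \<Phi>) \<longleftrightarrow> von_neumann_algebra (fixed_points M \<Phi>)"
    using fixed_points_von_neumann_algebra[OF assms] by (auto simp: von_neumann_algebra_def)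
next
  show "mult_stable (fixed_points M \<Phi>) \<longleftrightarrow> fixed_points M \<Phi> = bimodule_domain M \<Phi>"
    using assms by (rule fixed_points_eq_bimodule_domain_iff)
next
  fix \<Psi>
  assume "completely_positive M \<Psi> \<and> \<Psi> id_blinfun = id_blinfun \<and> idempotent_on M \<Psi> \<and>
    fixed_points M \<Phi> = \<Psi> ` M"
  then show "mult_stable (fixed_points M \<Phi>) \<longleftrightarrow> conditional_expectation M \<Psi>"
    using mult_stable_range_iff_conditional_expectation[OF assms(1)] by metis
next
  assume "M = bops \<and> mult_stable (fixed_points M \<Phi>)"
  then show "von_neumann_algebra (fixed_points M \<Phi>)"
    using fixed_points_von_neumann_algebra[OF assms] by blast
next
  assume M: "M = bops \<and> mult_stable (fixed_points M \<Phi>)"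
  obtain E where E: "completely_positive M E" "E id_blinfun = id_blinfun" "idempotent_on M E"
    "fixed_points M \<Phi> = E ` M"
    using ergodic_projection[OF assms] by blast
  have "completely_contractive M E" by (rule cp_completely_contractive[OF assms(1) E(1,2)])
  with E M show "injective_space (fixed_points M \<Phi>)"
    unfolding injective_space_def by blast
qed

end
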